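(* Let $k,p\in\mathbb{N}$ and $\mathbf m=(m_1,\ldots,m_p)\in\mathbb{N}^p$ with $m_p\ge2$. Then $$\sum_{j=1}^{p+1}(-1)^{j-1}\,t(m_p,m_{p-1},\ldots,m_j)\sum_{n=1}^\infty\frac{t_n^\star(m_1,\ldots,m_{j-1})}{n^{k}4^n}\binom{2n}{n}\in\mathsf{CMZV}^4_{|\mathbf m|+k},$$ where $|\mathbf m|=m_1+\cdots+m_p$, and where for $j=p+1$ the factor $t(m_p,\ldots,m_j)$ is $t(\emptyset)=1$, and for $j=1$ the factor $t_n^\star(m_1,\ldots,m_{j-1})$ is $t_n^\star(\emptyset)=1$.
   Context: $\mathbb{N}$ is the set of positive integers. Multiple $t$-values: for $k_1\ge2$, $t(k_1,\ldots,k_r)=\sum_{n_1>n_2>\cdots>n_r>0}\prod_{j=1}^r\frac{1}{(2n_j-1)^{k_j}}$. Multiple $t$-harmonic star sums: $t_n^\star(k_1,\ldots,k_r)=\sum_{n\ge n_1\ge n_2\ge\cdots\ge n_r>0}\prod_{j=1}^r\frac{1}{(2n_j-1)^{k_j}}$. Colored multiple zeta values of level $N$: for $N$th roots of unity $z_1,\ldots,z_r$ and positive integers $k_1,\ldots,k_r$ with $(k_1,z_1)\ne(1,1)$, $\operatorname{Li}_{k_1,\ldots,k_r}(z_1,\ldots,z_r)=\sum_{n_1>\cdots>n_r>0}\frac{z_1^{n_1}\cdots z_r^{n_r}}{n_1^{k_1}\cdots n_r^{k_r}}$ (limit of the truncations $n_1\le M$ as $M\to\infty$). $\mathsf{CMZV}^{N}_w$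 is the $\mathbb{Q}$-span of all such values of level $N$ with weight $k_1+\cdots+k_r=w$. *)

theory Defs
  imports "HOL-Analysis.Analysis"
begin

text \<open>
  An index \<open>(k\<^sub>1, \<dots>, k\<^sub>r)\<close> is a list of naturals, and a tuple of summation variables
  \<open>(n\<^sub>1, \<dots>, n\<^sub>r)\<close> is a decreasing list of positive naturals of the same length. For the
  empty index the only such tuple is \<open>[]\<close>, so the sums below evaluate to 1.
\<close>

definition strict_tuples :: "nat \<Rightarrow> nat list set" where
  "strict_tuples r = {ns. length ns = r \<and> sorted_wrt (>) ns \<and> set ns \<subseteq> {1..}}"

definition weak_tuples :: "nat \<Rightarrow> nat list set" where
  "weak_tuples r = {ns. length ns = r \<and> sorted_wrt (\<ge>) ns \<and> set ns \<subseteq> {1..}}"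

definition t_term :: "nat list \<Rightarrow> nat list \<Rightarrow> real" where
  "t_term ks ns = (\<Prod>j<length ks. 1 / (2 * real (ns ! j) - 1) ^ (ks ! j))"

text \<open>
  Meaningful if the head of the index is at least 2 (or the index is empty); otherwise the
  family is not summable and \<open>infsum\<close> returns 0.
\<close>
definition multiple_t :: "nat list \<Rightarrow> real" where
  "multiple_t ks = (\<Sum>\<^sub>\<infinity>ns\<in>strict_tuples (length ks). t_term ks ns)"

definition multiple_t_star :: "nat \<Rightarrow> nat list \<Rightarrow> real" where
  "multiple_t_star n ks =
     (\<Sum>ns\<in>{ns \<in> weak_tuples (length ks). set ns \<subseteq> {1..n}}. t_term ks ns)"

text \<open>
  Colored multiple zeta values can converge only conditionally (\<open>k\<^sub>1 = 1\<close>), hence the limit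
  of truncations instead of an unordered sum.
\<close>
definition colored_Li :: "nat list \<Rightarrow> complex list \<Rightarrow> complex" where
  "colored_Li ks zs =
     lim (\<lambda>M. \<Sum>ns\<in>{ns \<in> strict_tuples (length ks). set ns \<subseteq> {1..M}}.
                (\<Prod>j<length ks. (zs ! j) ^ (ns ! j) / of_nat (ns ! j) ^ (ks ! j)))"

definition colored_mzvs :: "nat \<Rightarrow> nat \<Rightarrow> complex set" where
  "colored_mzvs N w = {colored_Li ks zs | ks zs.
     ks \<noteq> [] \<and> length zs = length ks \<and> (\<forall>k\<in>set ks. k \<ge> 1) \<and> (\<forall>z\<in>set zs. z ^ N = 1) \<and>
     (hd ks, hd zs) \<noteq> (1, 1) \<and> sum_list ks = w}"

global_interpretation rat_complex: vector_space "\<lambda>(q :: rat) (z :: complex). of_rat q * z"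
  by standard (simp_all add: algebra_simps of_rat_add of_rat_mult)

definition CMZV :: "nat \<Rightarrow> nat \<Rightarrow> complex set" where
  "CMZV N w = rat_complex.span (colored_mzvs N w)"

end

theory Submission
  imports Defs "HOL-Library.Function_Algebras"
begin

text \<open>
  Cutting every chain \<open>n\<^sub>p > \<dots> > n\<^sub>j\<close> at \<open>n\<close> turns the alternating sum over \<open>j\<close>, for fixed \<open>n\<close>, into
  an antipode relation between strict and weak nested sums. It collapses to the single tail
  sum over \<open>n\<^sub>p > \<dots> > n\<^sub>1 > n\<close>, so the number in question is the nested sum
  \[ \sum_{n_p > \dots > n_1 > n \ge 1} \prod_j \frac{1}{(2 n_j - 1)^{m_j}} \cdot
     \frac{1}{n^k 4^n} \binom{2n}{n} \]
  (lemmas \<open>antipode_tail\<close> and \<open>alternating_sum_eq_suminf\<close>).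

  Multiply each term by the power of \<open>x\<close> with exponent \<open>2 n\<^sub>p - 1\<close> to obtain a function \<open>f(x)\<close> whose value
  at 1 is this sum. It is an iterated integral, up to powers of 2: a factor \<open>1/n\<close> or \<open>1/(2 n - 1)\<close> is an
  integration against \<open>dx/x\<close>, a new summation variable one against \<open>dx/(1 - x\<^sup>2)\<close> or
  \<open>x dx/(1 - x\<^sup>2)\<close>, and the innermost form is
  \<open>(1/sqrt(1 - x\<^sup>2) - 1) dx/x\<close> by the binomial series. The square root disappears under
  \<open>x = 2u/(1 + u\<^sup>2)\<close>, which maps the interval from 0 to 1 onto itself and fixes both ends. With
  \<open>\<omega>\<^sub>\<zeta> = \<zeta> du/(1 - \<zeta>u)\<close> the forms become
  \[ \frac{dx}{x} = \frac{du}{u} + \omega_i + \omega_{-i}, \quad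
     \frac{dx}{1 - x^2} = \omega_1 - \omega_{-1}, \quad
     \frac{x\,dx}{1 - x^2} = \omega_1 + \omega_{-1} - \omega_i - \omega_{-i}, \quad
     \Big(\frac{1}{\sqrt{1 - x^2}} - 1\Big) \frac{dx}{x} = - (\omega_i + \omega_{-i}). \]
  All are rational combinations of \<open>du/u\<close> and \<open>\<omega>\<^sub>\<zeta>\<close> with \<open>\<zeta>\<^sup>4 = 1\<close>, and each integration raises the weight by
  one. Integration against these forms preserves the rational span of the multiple polylogarithms
  in \<open>u\<close> with fourth roots of unity (lemmas \<open>integrable_dlog\<close> and \<open>integrable_letter\<close>), so
  \<open>f(2u/(1 + u\<^sup>2))\<close> lies in that span. As \<open>m\<^sub>p \<ge> 2\<close>, the last integration is against \<open>dx/x\<close>, which does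
  not involve \<open>\<omega>\<^sub>1\<close>; hence only indices with \<open>(k\<^sub>1, z\<^sub>1) \<noteq> (1, 1)\<close> occur, their series converge at
  \<open>u = 1\<close>, and Abel's limit theorem identifies the limits at 1 on both sides.

  The identity in \<open>u\<close> is never expanded: both sides are continuous on the half-open unit interval, vanish
  at 0 and have equal derivatives (\<open>primitive_unique\<close>).
\<close>

section \<open>Nested sums over chains of integers\<close>

text \<open>
  A list of functions \<open>[f\<^sub>1, \<dots>, f\<^sub>r]\<close> stands for the summand \<open>f\<^sub>1(n\<^sub>1) \<dots> f\<^sub>r(n\<^sub>r)\<close>, summed over
  \<open>b > n\<^sub>1 > \<dots> > n\<^sub>r > a\<close>. Arbitrary summands allow multiple \<open>t\<close>-values, colored zeta values and the
  binomial factor to share one recursion; the lower bound \<open>a\<close> is what the antipode relation moves.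
\<close>
fun nested :: "(nat \<Rightarrow> 'a::comm_semiring_1) list \<Rightarrow> nat \<Rightarrow> nat \<Rightarrow> 'a" where
  "nested [] a b = 1"
| "nested (f # fs) a b = (\<Sum>l\<in>{a<..<b}. f l * nested fs a l)"

fun nested_star :: "(nat \<Rightarrow> 'a::comm_semiring_1) list \<Rightarrow> nat \<Rightarrow> 'a" where
  "nested_star [] n = 1"
| "nested_star (f # fs) n = (\<Sum>l\<in>{1..n}. f l * nested_star fs l)"

lemma finite_tuples:
  "finite {ns \<in> strict_tuples r. set ns \<subseteq> {1..M}}"
  "finite {ns \<in> weak_tuples r. set ns \<subseteq> {1..M}}"
  by (rule finite_subset[OF _ finite_lists_length_eq[of "{1..M}" r]];
      auto simp: strict_tuples_def weak_tuples_def)+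

lemma strict_tuples_Suc:
  "{ns \<in> strict_tuples (Suc r). set ns \<subseteq> {1..M}} =
    (\<lambda>(l, ns). l # ns) ` (SIGMA l:{1..M}. {ns \<in> strict_tuples r. set ns \<subseteq> {1..l - 1}})"
proof (intro set_eqI iffI)
  fix ns assume "ns \<in> {ns \<in> strict_tuples (Suc r). set ns \<subseteq> {1..M}}"
  then obtain l ns' where "ns = l # ns'" "l \<in> {1..M}"
      "ns' \<in> {ns \<in> strict_tuples r. set ns \<subseteq> {1..l - 1}}"
    by (cases ns) (force simp: strict_tuples_def subset_iff)+
  then show "ns \<in> (\<lambda>(l, ns). l # ns) ` (SIGMA l:{1..M}. {ns \<in> strict_tuples r. set ns \<subseteq> {1..l - 1}})"
    by force
qed (force simp: strict_tuples_def subset_iff)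

lemma weak_tuples_Suc:
  "{ns \<in> weak_tuples (Suc r). set ns \<subseteq> {1..M}} =
    (\<lambda>(l, ns). l # ns) ` (SIGMA l:{1..M}. {ns \<in> weak_tuples r. set ns \<subseteq> {1..l}})"
proof (intro set_eqI iffI)
  fix ns assume "ns \<in> {ns \<in> weak_tuples (Suc r). set ns \<subseteq> {1..M}}"
  then obtain l ns' where "ns = l # ns'" "l \<in> {1..M}"
      "ns' \<in> {ns \<in> weak_tuples r. set ns \<subseteq> {1..l}}"
    by (cases ns) (force simp: weak_tuples_def subset_iff)+
  then show "ns \<in> (\<lambda>(l, ns). l # ns) ` (SIGMA l:{1..M}. {ns \<in> weak_tuples r. set ns \<subseteq> {1..l}})"
    by force
qed (force simp: weak_tuples_def subset_iff)

lemma sum_strict_tuples: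
  "(\<Sum>ns\<in>{ns \<in> strict_tuples (length fs). set ns \<subseteq> {1..M}}. \<Prod>j<length fs. (fs ! j) (ns ! j))
    = nested fs 0 (M + 1)"
proof (induction fs arbitrary: M)
  case Nil
  have "{ns \<in> strict_tuples 0. set ns \<subseteq> {1..M}} = {[]}"
    by (auto simp: strict_tuples_def)
  then show ?case by simp
next
  case (Cons f fs)
  have inj: "inj_on (\<lambda>(l, ns). l # ns) X" for X :: "(nat \<times> nat list) set"
    by (auto simp: inj_on_def)
  have "(\<Sum>ns\<in>{ns \<in> strict_tuples (length (f # fs)). set ns \<subseteq> {1..M}}.
          \<Prod>j<length (f # fs). ((f # fs) ! j) (ns ! j))
      = (\<Sum>l\<in>{1..M}. \<Sum>ns\<in>{ns \<in> strict_tuples (length fs). set ns \<subseteq> {1..l - 1}}.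
          f l * (\<Prod>j<length fs. (fs ! j) (ns ! j)))"
    unfolding length_Cons strict_tuples_Suc
    by (subst sum.reindex[OF inj], subst sum.Sigma)
       (auto simp add: finite_tuples[simplified] prod.lessThan_Suc_shift case_prod_unfold
          simp del: prod.lessThan_Suc)
  also have "\<dots> = (\<Sum>l\<in>{1..M}. f l * nested fs 0 l)"
    by (rule sum.cong) (use Cons.IH in \<open>auto simp: sum_distrib_left[symmetric]\<close>)
  also have "\<dots> = nested (f # fs) 0 (M + 1)"
    unfolding nested.simps by (rule sum.cong) auto
  finally show ?case .
qed

lemma sum_weak_tuples:
  "(\<Sum>ns\<in>{ns \<in> weak_tuples (length fs). set ns \<subseteq> {1..M}}. \<Prod>j<length fs. (fs ! j) (ns ! j))
    = nested_star fs M"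
proof (induction fs arbitrary: M)
  case Nil
  have "{ns \<in> weak_tuples 0. set ns \<subseteq> {1..M}} = {[]}"
    by (auto simp: weak_tuples_def)
  then show ?case by simp
next
  case (Cons f fs)
  have inj: "inj_on (\<lambda>(l, ns). l # ns) X" for X :: "(nat \<times> nat list) set"
    by (auto simp: inj_on_def)
  have "(\<Sum>ns\<in>{ns \<in> weak_tuples (length (f # fs)). set ns \<subseteq> {1..M}}.
          \<Prod>j<length (f # fs). ((f # fs) ! j) (ns ! j))
      = (\<Sum>l\<in>{1..M}. \<Sum>ns\<in>{ns \<in> weak_tuples (length fs). set ns \<subseteq> {1..l}}.
          f l * (\<Prod>j<length fs. (fs ! j) (ns ! j)))"
    unfolding length_Cons weak_tuples_Suc
    by (subst sum.reindex[OF inj], subst sum.Sigma)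
       (auto simp add: finite_tuples[simplified] prod.lessThan_Suc_shift case_prod_unfold
          simp del: prod.lessThan_Suc)
  also have "\<dots> = (\<Sum>l\<in>{1..M}. f l * nested_star fs l)"
    by (rule sum.cong) (use Cons.IH in \<open>auto simp: sum_distrib_left[symmetric]\<close>)
  finally show ?case by simp
qed

text \<open>
  The defining recursion splits off the largest variable, this one the smallest.
\<close>
lemma nested_snoc:
  "nested (fs @ [g]) a b = (\<Sum>n\<in>{a<..<b}. g n * nested fs n b)"
proof (induction fs arbitrary: b)
  case Nil
  then show ?case by simp
next
  case (Cons f fs)
  have "nested ((f # fs) @ [g]) a b = (\<Sum>l\<in>{a<..<b}. \<Sum>n\<in>{a<..<l}. f l * (g n * nested fs n l))"
    by (simp add: Cons.IH sum_distrib_left)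
  also have "\<dots> = (\<Sum>l\<in>{a<..<b}. \<Sum>n | n \<in> {a<..<b} \<and> n < l. f l * (g n * nested fs n l))"
    by (intro sum.cong) auto
  also have "\<dots> = (\<Sum>n\<in>{a<..<b}. \<Sum>l | l \<in> {a<..<b} \<and> n < l. f l * (g n * nested fs n l))"
    by (rule sum.swap_restrict) auto
  also have "\<dots> = (\<Sum>n\<in>{a<..<b}. g n * (\<Sum>l\<in>{n<..<b}. f l * nested fs n l))"
    unfolding sum_distrib_left by (intro sum.cong) (auto simp: mult_ac)
  finally show ?case by simp
qed

text \<open>
  Lowering \<open>n + 1\<close> to \<open>n\<close> changes both sides by \<open>f(n + 1)\<close> times the same expression for the tail of
  the list: on the left through the largest variable of the weak sums, on the right through the
  smallest variable of the strict sum. At \<open>n = 0\<close> all nonempty weak sums vanish and only \<open>j = 0\<close>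
  remains.
\<close>
lemma antipode_tail:
  fixes fs :: "(nat \<Rightarrow> 'a::comm_ring_1) list"
  assumes "n < b"
  shows "(\<Sum>j\<le>length fs. (-1) ^ j * nested (rev (drop j fs)) 0 b * nested_star (take j fs) n)
         = nested (rev fs) n b"
  using assms
proof (induction fs arbitrary: n)
  case Nil
  then show ?case by simp
next
  case (Cons f fs)
  define Q where "Q = (\<lambda>fs n. \<Sum>j\<le>length fs.
      (-1) ^ j * nested (rev (drop j fs)) 0 b * nested_star (take j fs) n :: 'a)"
  have Q_Cons: "Q (f # fs) n = nested (rev (f # fs)) 0 b
      - (\<Sum>j\<le>length fs. (-1) ^ j * nested (rev (drop j fs)) 0 b * nested_star (f # take j fs) n)" for n
    by (simp add: Q_def sum.atMost_Suc_shift sum_negf del: sum.atMost_Suc nested_star.simps(2))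
  show ?case
    using Cons.prems
  proof (induction n)
    case 0
    show ?case
      using Q_Cons[of 0] by (simp add: Q_def)
  next
    case (Suc n)
    have step: "Q (f # fs) (Suc n) = Q (f # fs) n - f (Suc n) * Q fs (Suc n)"
      unfolding Q_Cons
      by (simp add: Q_def sum_distrib_left sum.distrib[symmetric] algebra_simps)
    have IH: "Q fs (Suc n) = nested (rev fs) (Suc n) b"
      using Cons.IH[OF Suc.prems] by (simp add: Q_def)
    have "{n<..<b} = insert (Suc n) {Suc n<..<b}"
      using Suc.prems by auto
    then have "nested (rev (f # fs)) n b
        = f (Suc n) * nested (rev fs) (Suc n) b + nested (rev (f # fs)) (Suc n) b"
      by (simp add: nested_snoc)
    moreover have "Q (f # fs) n = nested (rev (f # fs)) n b"
      using Suc by (simp add: Q_def)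
    ultimately show ?case
      using step IH by (simp add: Q_def)
  qed
qed

section \<open>Growth of nested sums\<close>

text \<open>
  Nested sums with harmonic weights grow like powers of the logarithm. A bound by \<open>n\<^sup>1\<^sup>/\<^sup>4\<close> is
  cruder but is reproduced by every further summation, so a single exponent serves all depths; it
  is small enough to keep sums convergent whose terms otherwise decay like \<open>n\<^sup>-\<^sup>3\<^sup>/\<^sup>2\<close>, as the
  binomial factor does for \<open>k = 1\<close>.
\<close>
lemma sum_powr_le: "(\<Sum>l\<in>{1..n}. real l powr (-3/4)) \<le> 4 * real n powr (1/4)"
proof (induction n)
  case 0
  then show ?case by simp
next
  case (Suc n)
  define s t where "s = real n powr (1/4)" and "t = real (Suc n) powr (1/4)"
  have st: "0 \<le> s" "s \<le> t" "0 < t"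
    by (auto simp: s_def t_def intro!: powr_mono2)
  have s4: "s ^ 4 = real n" and t4: "t ^ 4 = real n + 1"
    by (cases "n = 0"; simp add: s_def t_def powr_power)+
  have t3: "real (Suc n) powr (-3/4) * t ^ 3 = 1"
    by (simp add: t_def powr_power flip: powr_add)
  \<comment> \<open>factor \<open>1 = t\<^sup>4 - s\<^sup>4\<close> as \<open>(t - s)(t\<^sup>3 + t\<^sup>2 s + t s\<^sup>2 + s\<^sup>3)\<close> and bound the second factor\<close>
  have "s * (s * s) \<le> t * (t * t)" "s * (s * t) \<le> t * (t * t)" "s * (t * t) \<le> t * (t * t)"
    using st by (intro mult_mono; simp)+
  then have "t ^ 3 + t\<^sup>2 * s + t * s\<^sup>2 + s ^ 3 \<le> 4 * t ^ 3"
    by (simp add: power2_eq_square power3_eq_cube mult_ac)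
  then have "(t - s) * (t ^ 3 + t\<^sup>2 * s + t * s\<^sup>2 + s ^ 3) \<le> (t - s) * (4 * t ^ 3)"
    using st by (intro mult_left_mono) auto
  moreover have "(t - s) * (t ^ 3 + t\<^sup>2 * s + t * s\<^sup>2 + s ^ 3) = t ^ 4 - s ^ 4"
    by (simp add: algebra_simps power_numeral_reduce power2_eq_square)
  ultimately have "real (Suc n) powr (-3/4) * t ^ 3 \<le> (4 * (t - s)) * t ^ 3"
    using s4 t4 t3 by (simp add: algebra_simps)
  then have "real (Suc n) powr (-3/4) \<le> 4 * (t - s)"
    using st by (simp add: mult_le_cancel_right)
  then show ?case
    using Suc.IH by (simp add: s_def t_def)
qed

definition harmonic_decay :: "(nat \<Rightarrow> 'a::real_normed_field) \<Rightarrow> bool" where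
  "harmonic_decay f \<longleftrightarrow> (\<exists>C\<ge>0. \<forall>l\<ge>1. norm (f l) \<le> C / real l)"

lemma sum_decay_bound:
  fixes f :: "nat \<Rightarrow> 'a::real_normed_field"
  assumes C: "C \<ge> 0" "\<And>l. l \<ge> 1 \<Longrightarrow> norm (f l) \<le> C / real l"
    and D: "D \<ge> 0" "\<And>l. l \<ge> 1 \<Longrightarrow> norm (g l) \<le> D * real l powr (1/4)"
    and I: "I \<subseteq> {1..n}"
  shows "norm (\<Sum>l\<in>I. f l * g l) \<le> 4 * C * D * real n powr (1/4)"
proof -
  have "norm (\<Sum>l\<in>I. f l * g l) \<le> (\<Sum>l\<in>I. C * D * real l powr (-3/4))"
  proof (rule sum_norm_le)
    fix l assume "l \<in> I"
    then have l: "l \<ge> 1" using I by auto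
    have "norm (f l * g l) \<le> (C / real l) * (D * real l powr (1/4))"
      unfolding norm_mult by (intro mult_mono C D l) (use C in auto)
    also have "real l powr (1/4) = real l * real l powr (-3/4)"
      using l by (simp add: powr_mult_base)
    finally show "norm (f l * g l) \<le> C * D * real l powr (-3/4)"
      using l by (simp add: mult_ac)
  qed
  also have "\<dots> \<le> (\<Sum>l\<in>{1..n}. C * D * real l powr (-3/4))"
    using C(1) D(1) I by (intro sum_mono2) auto
  also have "\<dots> \<le> C * D * (4 * real n powr (1/4))"
    unfolding sum_distrib_left[symmetric]
    using C(1) D(1) by (intro mult_left_mono sum_powr_le) auto
  finally show ?thesis by (simp add: mult_ac)
qed

lemma nested_bound:
  fixes fs :: "(nat \<Rightarrow> 'a::real_normed_field) list"
  assumes "\<And>f. f \<in> set fs \<Longrightarrow> harmonic_decay f"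
  obtains D where "D \<ge> 0" "\<And>a b. b \<ge> 1 \<Longrightarrow> norm (nested fs a b) \<le> D * real b powr (1/4)"
proof -
  have "\<exists>D\<ge>0. \<forall>a b. b \<ge> 1 \<longrightarrow> norm (nested fs a b) \<le> D * real b powr (1/4)"
    using assms
  proof (induction fs)
    case Nil
    show ?case
      by (intro exI[of _ 1]) (auto intro!: ge_one_powr_ge_zero)
  next
    case (Cons f fs)
    then obtain D where D: "D \<ge> 0" "\<And>a b. b \<ge> 1 \<Longrightarrow> norm (nested fs a b) \<le> D * real b powr (1/4)"
      by auto
    obtain C where C: "C \<ge> 0" "\<And>l. l \<ge> 1 \<Longrightarrow> norm (f l) \<le> C / real l"
      using Cons.prems[of f] by (auto simp: harmonic_decay_def)
    have "norm (nested (f # fs) a b) \<le> 4 * C * D * real b powr (1/4)" for a b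
      unfolding nested.simps by (rule sum_decay_bound[OF C D]) auto
    then show ?case
      using C D by (intro exI[of _ "4 * C * D"]) auto
  qed
  then show ?thesis using that by blast
qed

lemma nested_star_bound:
  fixes fs :: "(nat \<Rightarrow> 'a::real_normed_field) list"
  assumes "\<And>f. f \<in> set fs \<Longrightarrow> harmonic_decay f"
  obtains D where "D \<ge> 0" "\<And>n. n \<ge> 1 \<Longrightarrow> norm (nested_star fs n) \<le> D * real n powr (1/4)"
proof -
  have "\<exists>D\<ge>0. \<forall>n. n \<ge> 1 \<longrightarrow> norm (nested_star fs n) \<le> D * real n powr (1/4)"
    using assms
  proof (induction fs)
    case Nil
    show ?case
      by (intro exI[of _ 1]) (auto intro!: ge_one_powr_ge_zero)
  next
    case (Cons f fs)
    then obtain D where D: "D \<ge> 0" "\<And>n. n \<ge> 1 \<Longrightarrow> norm (nested_star fs n) \<le> D * real n powr (1/4)"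
      by auto
    obtain C where C: "C \<ge> 0" "\<And>l. l \<ge> 1 \<Longrightarrow> norm (f l) \<le> C / real l"
      using Cons.prems[of f] by (auto simp: harmonic_decay_def)
    have "norm (nested_star (f # fs) n) \<le> 4 * C * D * real n powr (1/4)" for n
      unfolding nested_star.simps by (rule sum_decay_bound[OF C D]) auto
    then show ?case
      using C D by (intro exI[of _ "4 * C * D"]) auto
  qed
  then show ?thesis using that by blast
qed

lemma summable_times_quarter_growth:
  fixes c g :: "nat \<Rightarrow> 'a::{real_normed_field,banach}"
  assumes c: "\<And>n. n \<ge> 1 \<Longrightarrow> norm (c n) \<le> C * real n powr (-3/2)"
    and g: "\<And>n. n \<ge> 1 \<Longrightarrow> norm (g n) \<le> D * real n powr (1/4)"
  shows "summable (\<lambda>n. norm (c n * g n))"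
proof (rule summable_comparison_test')
  show "summable (\<lambda>n. C * D * real n powr (-5/4))"
    by (intro summable_mult) (simp add: summable_real_powr_iff)
  fix n :: nat assume n: "n \<ge> 1"
  have "0 \<le> C * real n powr (-3/2)"
    using c[OF n] norm_ge_zero order_trans by blast
  then have "norm (c n * g n) \<le> (C * real n powr (-3/2)) * (D * real n powr (1/4))"
    unfolding norm_mult using c[OF n] g[OF n] by (intro mult_mono) auto
  also have "\<dots> = C * D * (real n powr (-3/2) * real n powr (1/4))"
    by (simp add: mult_ac)
  also have "real n powr (-3/2) * real n powr (1/4) = real n powr (-5/4)"
    by (simp flip: powr_add)
  finally show "norm (norm (c n * g n)) \<le> C * D * real n powr (-5/4)"
    by simp
qed

section \<open>Power series at the boundary: Abel's limit theorem\<close>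

lemma summable_linear_growth_powser:
  fixes c :: "nat \<Rightarrow> 'a::{real_normed_field,banach}"
  assumes "\<And>n. norm (c n) \<le> C * real (Suc n)" "norm x < 1"
  shows "summable (\<lambda>n. c n * x ^ n)"
proof (rule summable_comparison_test')
  show "summable (\<lambda>n. C * (of_nat (Suc n) * norm x ^ n))"
    using geometric_deriv_sums[of "norm x"] assms(2)
    by (intro summable_mult) (auto simp: sums_iff)
  show "norm (c n * x ^ n) \<le> C * (of_nat (Suc n) * norm x ^ n)" for n
    using mult_right_mono[OF assms(1)[of n], of "norm x ^ n"]
    by (simp add: norm_mult norm_power mult_ac)
qed

text \<open>
  Multiplication by \<open>1 - x\<close> takes differences of coefficients. Read backwards, a factor
  \<open>1/(1 - x)\<close> creates a new summation variable.
\<close>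
lemma one_minus_times_partial_sums_powser:
  fixes a :: "nat \<Rightarrow> 'a::{real_normed_field,banach}"
  assumes "summable (\<lambda>n. (\<Sum>l\<le>n. a l) * x ^ n)"
  shows "(\<lambda>n. a n * x ^ n) sums ((1 - x) * (\<Sum>n. (\<Sum>l\<le>n. a l) * x ^ n))"
proof -
  define S where "S = (\<lambda>n. \<Sum>l\<le>n. a l)"
  have 1: "(\<lambda>n. S n * x ^ n) sums (\<Sum>n. S n * x ^ n)"
    using assms by (simp add: S_def summable_sums)
  have "(\<lambda>n. if n = 0 then 0 else S (n - 1) * x ^ n) sums (x * (\<Sum>n. S n * x ^ n))"
    using sums_Suc[of "\<lambda>n. if n = 0 then 0 else S (n - 1) * x ^ n"] sums_mult[OF 1, of x]
    by (simp add: mult_ac)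
  from sums_diff[OF 1 this]
  have "(\<lambda>n. S n * x ^ n - (if n = 0 then 0 else S (n - 1) * x ^ n)) sums
      ((1 - x) * (\<Sum>n. S n * x ^ n))"
    by (simp add: algebra_simps)
  moreover have "S n * x ^ n - (if n = 0 then 0 else S (n - 1) * x ^ n) = a n * x ^ n" for n
    by (cases n) (simp_all add: S_def algebra_simps)
  ultimately show ?thesis by (simp add: S_def)
qed

text \<open>
  Writing \<open>E n\<close> for the error of the \<open>n\<close>-th partial sum, the deviation from the limit is
  \<open>(1 - x) (\<Sum>n. E n x\<^sup>n)\<close>. Late errors are small and contribute at most \<open>\<epsilon>/2\<close> because of the
  factor \<open>1 - x\<close>; the finitely many early ones are killed by it as \<open>x\<close> tends to 1.
\<close>
theorem Abel_limit:
  fixes a :: "nat \<Rightarrow> 'a::{real_normed_field,banach}"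
  assumes "summable a"
  shows "((\<lambda>x. \<Sum>n. a n * of_real x ^ n) \<longlongrightarrow> suminf a) (at_left 1)"
proof (rule tendstoI)
  fix \<epsilon> :: real assume \<epsilon>: "\<epsilon> > 0"
  define s S where "s = suminf a" and "S = (\<lambda>n. \<Sum>l\<le>n. a l)"
  define E where "E = (\<lambda>n. S n - s)"
  have "E \<longlonglongrightarrow> s - s"
    unfolding E_def S_def s_def
    by (intro tendsto_diff tendsto_const summable_LIMSEQ'[OF assms])
  then have E0: "E \<longlonglongrightarrow> 0" by simp
  then obtain B where B: "\<And>n. norm (E n) \<le> B"
    using convergent_imp_Bseq[of E] by (auto simp: convergent_def Bseq_def)
  obtain N where N: "\<And>n. n \<ge> N \<Longrightarrow> norm (E n) < \<epsilon> / 2"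
    using LIMSEQ_D[OF E0, of "\<epsilon> / 2"] \<epsilon> by auto
  define K where "K = (\<Sum>n<N. norm (E n))"
  have bound: "norm ((\<Sum>n. a n * of_real x ^ n) - s) \<le> (1 - x) * K + \<epsilon> / 2"
    if x: "0 < x" "x < 1" for x :: real
  proof -
    have gx: "summable (\<lambda>n. x ^ n)" "(\<Sum>n. x ^ n) = 1 / (1 - x)"
      using x by (simp_all add: suminf_geometric)
    have E_abs: "summable (\<lambda>n. norm (E n) * x ^ n)"
      by (rule summable_comparison_test'[OF summable_mult[OF gx(1), of B]])
         (use B x in \<open>auto intro!: mult_right_mono\<close>)
    then have E_sum: "summable (\<lambda>n. E n * of_real x ^ n)"
      using x by (intro summable_norm_cancel[of "\<lambda>n. E n * of_real x ^ n"])
        (simp add: norm_mult norm_power)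
    have gs: "(\<lambda>n. s * of_real x ^ n) sums (s * (1 / (1 - of_real x)))"
      using x by (intro sums_mult geometric_sums) simp
    have "(\<lambda>n. S n * of_real x ^ n) sums ((\<Sum>n. E n * of_real x ^ n) + s * (1 / (1 - of_real x)))"
      using sums_add[OF summable_sums[OF E_sum] gs] by (simp add: E_def algebra_simps)
    then have "(\<lambda>n. a n * of_real x ^ n) sums
        ((1 - of_real x) * ((\<Sum>n. E n * of_real x ^ n) + s * (1 / (1 - of_real x))))"
      using one_minus_times_partial_sums_powser[of a "of_real x"] by (simp add: S_def sums_iff)
    then have "(\<Sum>n. a n * of_real x ^ n) =
        (1 - of_real x) * (\<Sum>n. E n * of_real x ^ n) + (1 - of_real x) * (s * (1 / (1 - of_real x)))"
      by (simp add: sums_iff distrib_left)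
    moreover have "(1::'a) - of_real x \<noteq> 0"
      using x by (metis less_irrefl of_real_1 of_real_eq_iff right_minus_eq)
    ultimately have "(\<Sum>n. a n * of_real x ^ n) - s = of_real (1 - x) * (\<Sum>n. E n * of_real x ^ n)"
      by simp
    then have eq: "norm ((\<Sum>n. a n * of_real x ^ n) - s) = (1 - x) * norm (\<Sum>n. E n * of_real x ^ n)"
      using x by (simp add: norm_mult del: of_real_diff)
    have "norm (\<Sum>n. E n * of_real x ^ n) \<le> (\<Sum>n. norm (E n) * x ^ n)"
      using summable_norm[of "\<lambda>n. E n * of_real x ^ n"] E_abs x by (simp add: norm_mult norm_power)
    also have "\<dots> \<le> (\<Sum>n. (if n < N then norm (E n) else 0) + \<epsilon> / 2 * x ^ n)"
    proof (rule suminf_le[OF _ E_abs])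
      show "norm (E n) * x ^ n \<le> (if n < N then norm (E n) else 0) + \<epsilon> / 2 * x ^ n" for n
      proof (cases "n < N")
        case True
        have "norm (E n) * x ^ n \<le> norm (E n) * 1"
          using x by (intro mult_left_mono power_le_one) auto
        then show ?thesis using True x \<epsilon> by (simp add: add_increasing2)
      next
        case False
        then show ?thesis using N[of n] x by (auto intro!: mult_right_mono)
      qed
      show "summable (\<lambda>n. (if n < N then norm (E n) else 0) + \<epsilon> / 2 * x ^ n)"
        by (intro summable_add summable_mult gx) (auto intro: summable_finite[of "{..<N}"])
    qed
    also have "\<dots> = (\<Sum>n. (if n < N then norm (E n) else 0)) + (\<Sum>n. \<epsilon> / 2 * x ^ n)"
      by (intro suminf_add[symmetric] summable_mult gx) (auto intro: summable_finite[of "{..<N}"])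
    also have "(\<Sum>n. (if n < N then norm (E n) else 0)) = K"
      by (subst suminf_finite[of "{..<N}"]) (auto simp: K_def)
    also have "(\<Sum>n. \<epsilon> / 2 * x ^ n) = \<epsilon> / 2 * (1 / (1 - x))"
      using gx by (subst suminf_mult) auto
    finally have "(1 - x) * norm (\<Sum>n. E n * of_real x ^ n) \<le> (1 - x) * (K + \<epsilon> / 2 * (1 / (1 - x)))"
      using x by (intro mult_left_mono) auto
    also have "\<dots> = (1 - x) * K + \<epsilon> / 2"
      using x by (simp add: field_simps)
    finally show ?thesis using eq by simp
  qed
  have lim: "((\<lambda>x. (1 - x) * K + \<epsilon> / 2) \<longlongrightarrow> (1 - 1) * K + \<epsilon> / 2) (at_left 1)"
    by (intro tendsto_intros)
  have "eventually (\<lambda>x. (1 - x) * K + \<epsilon> / 2 < \<epsilon>) (at_left 1)"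
    by (rule order_tendstoD(2)[OF lim]) (use \<epsilon> in simp)
  moreover have "eventually (\<lambda>x::real. 0 < x \<and> x < 1) (at_left 1)"
    using eventually_at_left_real[of 0 1] by (simp add: greaterThanLessThan_iff)
  ultimately show "eventually (\<lambda>x. dist (\<Sum>n. a n * of_real x ^ n) (suminf a) < \<epsilon>) (at_left 1)"
    by eventually_elim (use bound in \<open>force simp: dist_norm s_def\<close>)
qed

text \<open>
  Summation by parts: \<open>z\<^sup>n b\<^sub>n\<close> is, up to the constant \<open>1/(z - 1)\<close>, a telescoping difference minus
  \<open>z\<^sup>n\<^sup>+\<^sup>1 (b\<^sub>n\<^sub>+\<^sub>1 - b\<^sub>n)\<close>. It gives the conditional convergence of colored values with \<open>k\<^sub>1 = 1\<close>.
\<close>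
lemma summable_power_times_bounded_variation:
  fixes z :: "'a::{real_normed_field,banach}"
  assumes "norm z \<le> 1" "z \<noteq> 1" "b \<longlonglongrightarrow> 0" "summable (\<lambda>n. norm (b (Suc n) - b n))"
  shows "summable (\<lambda>n. z ^ n * b n)"
proof -
  have "norm (z ^ n * b n) \<le> norm (b n)" for n
    using mult_right_mono[OF power_le_one[OF norm_ge_zero assms(1), of n], of "norm (b n)"]
    by (simp add: norm_mult norm_power)
  then have "(\<lambda>n. z ^ n * b n) \<longlonglongrightarrow> 0"
    by (intro Lim_null_comparison[OF _ tendsto_norm_zero[OF assms(3)]]) auto
  then have "summable (\<lambda>n. z ^ Suc n * b (Suc n) - z ^ n * b n)"
    by (rule telescope_summable)
  moreover have "norm (z ^ Suc n * (b (Suc n) - b n)) \<le> norm (b (Suc n) - b n)" for n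
    using mult_right_mono[OF power_le_one[OF norm_ge_zero assms(1), of "Suc n"], of "norm (b (Suc n) - b n)"]
    by (simp add: norm_mult norm_power)
  then have "summable (\<lambda>n. z ^ Suc n * (b (Suc n) - b n))"
    by (intro summable_comparison_test'[OF assms(4)])
  ultimately have "summable (\<lambda>n. (1 / (z - 1)) *
      ((z ^ Suc n * b (Suc n) - z ^ n * b n) - z ^ Suc n * (b (Suc n) - b n)))"
    by (intro summable_mult summable_diff[of "\<lambda>n. z ^ Suc n * b (Suc n) - z ^ n * b n"])
  also have "(\<lambda>n. (1 / (z - 1)) *
      ((z ^ Suc n * b (Suc n) - z ^ n * b n) - z ^ Suc n * (b (Suc n) - b n))) = (\<lambda>n. z ^ n * b n)"
  proof
    fix n
    have "(z ^ Suc n * b (Suc n) - z ^ n * b n) - z ^ Suc n * (b (Suc n) - b n) = (z - 1) * (z ^ n * b n)"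
      by (simp add: algebra_simps)
    then show "(1 / (z - 1)) *
      ((z ^ Suc n * b (Suc n) - z ^ n * b n) - z ^ Suc n * (b (Suc n) - b n)) = z ^ n * b n"
      using assms(2) by simp
  qed
  finally show ?thesis .
qed

text \<open>
  Coefficients of the generating function that records the largest summation variable; their
  partial sums are the nested sums. The empty list generates the constant function 1.
\<close>
fun coef :: "(nat \<Rightarrow> 'a::comm_semiring_1) list \<Rightarrow> nat \<Rightarrow> 'a" where
  "coef [] n = (if n = 0 then 1 else 0)"
| "coef (f # fs) n = f n * nested fs 0 n"

lemma sum_coef:
  assumes "fs = [] \<or> coef fs 0 = 0"
  shows "(\<Sum>l\<le>n. coef fs l) = nested fs 0 (Suc n)"
proof (cases fs)
  case Nil
  then show ?thesis by (simp add: sum.If_cases)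
next
  case (Cons f fs')
  have "{..n} = insert 0 {0<..<Suc n}" by auto
  then show ?thesis using assms Cons by simp
qed

lemma coef_bounded:
  fixes fs :: "(nat \<Rightarrow> 'a::real_normed_field) list"
  assumes "\<And>f. f \<in> set fs \<Longrightarrow> harmonic_decay f"
  obtains C where "C \<ge> 0" "\<And>n. norm (coef fs n) \<le> C"
proof (cases fs)
  case Nil
  then show ?thesis by (intro that[of 1]) auto
next
  case (Cons f fs')
  obtain C where C: "C \<ge> 0" "\<And>l. l \<ge> 1 \<Longrightarrow> norm (f l) \<le> C / real l"
    using assms[of f] Cons by (auto simp: harmonic_decay_def)
  obtain D where D: "D \<ge> 0" "\<And>a b. b \<ge> 1 \<Longrightarrow> norm (nested fs' a b) \<le> D * real b powr (1/4)"
    using nested_bound[of fs'] assms Cons by auto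
  have "norm (coef fs n) \<le> max (norm (coef fs 0)) (C * D)" for n
  proof (cases "n = 0")
    case False
    then have n: "n \<ge> 1" by simp
    have "norm (coef fs n) \<le> (C / real n) * (D * real n powr (1/4))"
      unfolding Cons coef.simps norm_mult using C D n by (intro mult_mono) auto
    also have "\<dots> \<le> (C / real n) * (D * real n powr 1)"
      using C D n by (intro mult_left_mono powr_mono) auto
    also have "\<dots> = C * D" using n by simp
    finally show ?thesis by simp
  qed simp
  then show ?thesis by (intro that[of "max (norm (coef fs 0)) (C * D)"]) (auto simp: le_max_iff_disj)
qed

lemma summable_bounded_powser:
  fixes c :: "nat \<Rightarrow> 'a::{real_normed_field,banach}"
  assumes "\<And>n. norm (c n) \<le> C" "norm x < 1"
  shows "summable (\<lambda>n. c n * x ^ n)"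
proof (rule summable_linear_growth_powser[OF _ assms(2)])
  have "C \<ge> 0" using order_trans[OF norm_ge_zero assms(1)] .
  then have "C * 1 \<le> C * real (Suc n)" for n
    by (intro mult_left_mono) auto
  then show "norm (c n) \<le> C * real (Suc n)" for n
    using order_trans[OF assms(1)] by simp
qed

lemma powser_partial_sums:
  fixes c :: "nat \<Rightarrow> 'a::{real_normed_field,banach}"
  assumes "\<And>n. norm (c n) \<le> C" "norm x < 1"
  shows "(\<Sum>n. (\<Sum>l\<le>n. c l) * x ^ n) = (\<Sum>n. c n * x ^ n) / (1 - x)"
proof -
  have "norm (\<Sum>l\<le>n. c l) \<le> C * real (Suc n)" for n
    using sum_norm_le[of "{..n}" c "\<lambda>_. C"] assms(1) by (simp add: mult.commute)
  from one_minus_times_partial_sums_powser[OF summable_linear_growth_powser[OF this assms(2)]]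
  have "(1 - x) * (\<Sum>n. (\<Sum>l\<le>n. c l) * x ^ n) = (\<Sum>n. c n * x ^ n)"
    by (simp add: sums_iff)
  moreover have "1 - x \<noteq> 0" using assms(2) by auto
  ultimately show ?thesis by (simp add: field_simps)
qed

lemma DERIV_bounded_powser:
  fixes c :: "nat \<Rightarrow> 'a::{real_normed_field,banach}"
  assumes "\<And>n. norm (c n) \<le> C" "norm x < 1"
  shows "((\<lambda>x. \<Sum>n. c n * x ^ n) has_field_derivative
           (\<Sum>n. of_nat (Suc n) * c (Suc n) * x ^ n)) (at x)"
proof -
  define K :: 'a where "K = of_real ((1 + norm x) / 2)"
  have K: "norm K = (1 + norm x) / 2" unfolding K_def norm_of_real by simp
  have "summable (\<lambda>n. c n * K ^ n)" "norm x < norm K"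
    using assms(2) K by (auto intro!: summable_bounded_powser[OF assms(1)])
  from termdiffs_strong[OF this] show ?thesis
    by (simp add: diffs_def)
qed

section \<open>Multiple polylogarithms in one variable\<close>

text \<open>
  With \<open>coef (map power_wt ps)\<close> these are the coefficients of
  \<open>Li\<^bsub>k\<^sub>1,\<dots>,k\<^sub>r\<^esub>(z\<^sub>1 u, z\<^sub>2, \<dots>, z\<^sub>r)\<close> for \<open>ps = [(k\<^sub>1, z\<^sub>1), \<dots>, (k\<^sub>r, z\<^sub>r)]\<close>.
\<close>
definition power_wt :: "nat \<times> complex \<Rightarrow> nat \<Rightarrow> complex" where
  "power_wt p n = snd p ^ n / of_nat n ^ fst p"

definition polylog :: "(nat \<times> complex) list \<Rightarrow> complex \<Rightarrow> complex" where
  "polylog ps u = (\<Sum>n. coef (map power_wt ps) n * u ^ n)"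

definition level_index :: "nat \<Rightarrow> (nat \<times> complex) list \<Rightarrow> bool" where
  "level_index N ps \<longleftrightarrow> (\<forall>(k, z)\<in>set ps. k \<ge> 1 \<and> z ^ N = 1)"

lemma power_wt_bound:
  assumes "k \<ge> r" "z ^ N = 1" "N > 0" "l \<ge> 1"
  shows "norm (power_wt (k, z) l) \<le> 1 / real l ^ r"
proof -
  have "norm z = 1" using assms power_eq_1_iff[of z N] by auto
  then show ?thesis
    using assms by (auto simp: power_wt_def norm_divide norm_power intro!: divide_left_mono power_increasing)
qed

lemma harmonic_decay_power_wt:
  assumes "level_index N ps" "N > 0" "f \<in> set (map power_wt ps)"
  shows "harmonic_decay f"
proof -
  obtain k z where "f = power_wt (k, z)" "k \<ge> 1" "z ^ N = 1"
    using assms by (auto simp: level_index_def)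
  with power_wt_bound[of 1 k z N] assms(2) show ?thesis
    by (auto simp: harmonic_decay_def intro!: exI[of _ 1])
qed

lemma coef_power_wt_0: "level_index N ps \<Longrightarrow> map power_wt ps = [] \<or> coef (map power_wt ps) 0 = 0"
  by (cases ps) (auto simp: level_index_def power_wt_def)

lemma polylog_0: "level_index N ps \<Longrightarrow> ps \<noteq> [] \<Longrightarrow> polylog ps 0 = 0"
  using coef_power_wt_0[of N ps] powser_zero[of "coef (map power_wt ps)"] by (simp add: polylog_def)

text \<open>
  Integration against \<open>du/u\<close> divides the coefficient of \<open>u\<^sup>n\<close> by \<open>n\<close>, which raises the first
  exponent.
\<close>
lemma polylog_DERIV_raise:
  assumes "level_index N ((k, z) # ps)" "N > 0" "norm u < 1" "u \<noteq> 0"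
  shows "(polylog ((Suc k, z) # ps) has_field_derivative (1 / u) * polylog ((k, z) # ps) u) (at u)"
proof -
  have l: "level_index N ((Suc k, z) # ps)"
    using assms(1) by (auto simp: level_index_def)
  obtain C where C: "\<And>n. norm (coef (map power_wt ((Suc k, z) # ps)) n) \<le> C"
    using coef_bounded[OF harmonic_decay_power_wt[OF l assms(2)]] by blast
  obtain C' where C': "\<And>n. norm (coef (map power_wt ((k, z) # ps)) n) \<le> C'"
    using coef_bounded[OF harmonic_decay_power_wt[OF assms(1,2)]] by blast
  have "(\<Sum>n. of_nat (Suc n) * coef (map power_wt ((Suc k, z) # ps)) (Suc n) * u ^ n)
      = (\<Sum>n. (1 / u) * (coef (map power_wt ((k, z) # ps)) (Suc n) * u ^ Suc n))"
    using assms(4) by (intro suminf_cong) (simp add: power_wt_def field_simps del: of_nat_Suc)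
  also have "\<dots> = (1 / u) * (\<Sum>n. coef (map power_wt ((k, z) # ps)) (Suc n) * u ^ Suc n)"
    using summable_bounded_powser[where c = "coef (map power_wt ((k, z) # ps))", OF C' assms(3)]
    by (intro suminf_mult) (subst summable_Suc_iff)
  also have "(\<Sum>n. coef (map power_wt ((k, z) # ps)) (Suc n) * u ^ Suc n) = polylog ((k, z) # ps) u"
    using suminf_split_head[OF summable_bounded_powser[where c = "coef (map power_wt ((k, z) # ps))", OF C' assms(3)]] coef_power_wt_0[OF assms(1)]
    by (simp add: polylog_def)
  finally show ?thesis
    using DERIV_bounded_powser[where c = "coef (map power_wt ((Suc k, z) # ps))", OF C assms(3)] by (simp add: polylog_def[abs_def])
qed

text \<open>
  In the iterated integral the letter \<open>\<zeta>\<close> multiplies the coefficient of \<open>u\<^sup>l\<close> by \<open>\<zeta>\<^sup>n\<^sup>-\<^sup>l\<close> on passing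
  from \<open>l\<close> to \<open>n\<close>. The factor \<open>\<zeta>\<^sup>n\<close> belongs to the new variable; \<open>\<zeta>\<^sup>-\<^sup>l\<close> is absorbed into the root of
  unity attached to the old one.
\<close>
fun twist :: "complex \<Rightarrow> (nat \<times> complex) list \<Rightarrow> (nat \<times> complex) list" where
  "twist \<zeta> [] = []"
| "twist \<zeta> ((k, z) # ps) = (k, z / \<zeta>) # ps"

lemma level_index_twist:
  "level_index N ps \<Longrightarrow> \<zeta> ^ N = 1 \<Longrightarrow> level_index N (twist \<zeta> ps)"
  by (cases ps) (auto simp: level_index_def power_divide)

lemma coef_twist:
  "\<zeta> \<noteq> 0 \<Longrightarrow> coef (map power_wt (twist \<zeta> ps)) n * \<zeta> ^ n = coef (map power_wt ps) n"
  by (cases ps) (auto simp: power_wt_def power_divide)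

text \<open>
  Since \<open>\<zeta>/(1 - \<zeta>u)\<close> is a geometric series in \<open>\<zeta>u\<close>, multiplication by it replaces twisted coefficients
  by their partial sums, and the subsequent division by \<open>n\<close> gives exponent 1 for the new variable.
\<close>
lemma polylog_DERIV_insert:
  assumes "level_index N ps" "N > 0" "\<zeta> ^ N = 1" "norm u < 1"
  shows "(polylog ((1, \<zeta>) # twist \<zeta> ps) has_field_derivative \<zeta> / (1 - \<zeta> * u) * polylog ps u) (at u)"
proof -
  have \<zeta>: "\<zeta> \<noteq> 0" "norm \<zeta> = 1"
    using assms power_eq_1_iff[of \<zeta> N] by (auto simp: zero_power)
  have t: "level_index N (twist \<zeta> ps)"
    using level_index_twist assms by blast
  have l: "level_index N ((1, \<zeta>) # twist \<zeta> ps)"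
    using t assms(3) by (auto simp: level_index_def)
  obtain C where C: "\<And>n. norm (coef (map power_wt ((1, \<zeta>) # twist \<zeta> ps)) n) \<le> C"
    using coef_bounded[OF harmonic_decay_power_wt[OF l assms(2)]] by blast
  define a where "a = coef (map power_wt (twist \<zeta> ps))"
  obtain C' where C': "\<And>n. norm (a n) \<le> C'"
    unfolding a_def using coef_bounded[OF harmonic_decay_power_wt[OF t assms(2)]] by blast
  have zu: "norm (\<zeta> * u) < 1"
    using \<zeta> assms(4) by (simp add: norm_mult)
  have linear: "norm (\<Sum>l\<le>n. a l) \<le> C' * real (Suc n)" for n
    using sum_norm_le[of "{..n}" a "\<lambda>_. C'"] C' by (simp add: mult.commute)
  have "(\<Sum>n. of_nat (Suc n) * coef (map power_wt ((1, \<zeta>) # twist \<zeta> ps)) (Suc n) * u ^ n)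
      = (\<Sum>n. \<zeta> * ((\<Sum>l\<le>n. a l) * (\<zeta> * u) ^ n))"
    using sum_coef[OF coef_power_wt_0[OF t]]
    by (intro suminf_cong) (simp add: power_wt_def a_def power_mult_distrib field_simps del: of_nat_Suc)
  also have "\<dots> = \<zeta> * (\<Sum>n. (\<Sum>l\<le>n. a l) * (\<zeta> * u) ^ n)"
    by (intro suminf_mult summable_linear_growth_powser[OF linear zu])
  also have "\<dots> = \<zeta> * ((\<Sum>n. a n * (\<zeta> * u) ^ n) / (1 - \<zeta> * u))"
    by (subst powser_partial_sums[OF C' zu]) simp
  also have "(\<Sum>n. a n * (\<zeta> * u) ^ n) = polylog ps u"
    unfolding polylog_def a_def
    by (intro suminf_cong) (simp add: power_mult_distrib coef_twist[OF \<zeta>(1)] flip: mult.assoc)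
  finally show ?thesis
    using DERIV_bounded_powser[where c = "coef (map power_wt ((1, \<zeta>) # twist \<zeta> ps))", OF C assms(4)]
    by (simp only: polylog_def[abs_def] times_divide_eq_left times_divide_eq_right)
qed

lemma polylog_field_differentiable:
  assumes "level_index N ps" "N > 0" "norm u < 1"
  shows "polylog ps field_differentiable (at u)"
proof -
  obtain C where C: "\<And>n. norm (coef (map power_wt ps) n) \<le> C"
    using coef_bounded[OF harmonic_decay_power_wt[OF assms(1,2)]] by blast
  show ?thesis
    using DERIV_bounded_powser[where c = "coef (map power_wt ps)", OF C assms(3)]
    by (auto simp: polylog_def[abs_def] field_differentiable_def)
qed

lemma summable_coef_square_decay:
  fixes fs :: "(nat \<Rightarrow> 'a::{real_normed_field,banach}) list"
  assumes "\<And>l. l \<ge> 1 \<Longrightarrow> norm (f l) \<le> C / real l ^ 2"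
    and "\<And>f. f \<in> set fs \<Longrightarrow> harmonic_decay f"
  shows "summable (\<lambda>n. norm (f n * nested fs a n))"
proof -
  obtain D where D: "D \<ge> 0" "\<And>a b. b \<ge> 1 \<Longrightarrow> norm (nested fs a b) \<le> D * real b powr (1/4)"
    using nested_bound[OF assms(2)] by blast
  have C: "C \<ge> 0"
    using order_trans[OF norm_ge_zero assms(1)[of 1]] by simp
  show ?thesis
  proof (rule summable_times_quarter_growth[OF _ D(2)])
    fix n :: nat assume n: "n \<ge> 1"
    have "norm (f n) \<le> C * real n powr (-2)"
      using assms(1)[OF n] n by (simp add: powr_minus powr_numeral field_simps)
    also have "\<dots> \<le> C * real n powr (-3/2)"
      using n C by (intro mult_left_mono powr_mono) auto
    finally show "norm (f n) \<le> C * real n powr (-3/2)" .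
  qed
qed

text \<open>
  For \<open>k\<^sub>1 \<ge> 2\<close> the growth bound gives absolute convergence. For \<open>k\<^sub>1 = 1\<close> the root of unity \<open>z\<^sub>1\<close> is not 1
  and \<open>b n = A n / n\<close>, with \<open>A\<close> the inner nested sum, has bounded variation: its increments are
  at most of the order of \<open>A n / n\<^sup>2\<close> or of \<open>A' n / n\<^sup>2\<close> for the nested sum \<open>A'\<close> of one depth less.
\<close>
lemma summable_coef_admissible:
  assumes "level_index N ps" "N > 0" "ps \<noteq> []" "hd ps \<noteq> (1, 1)"
  shows "summable (coef (map power_wt ps))"
proof -
  obtain k z qs where ps: "ps = (k, z) # qs"
    using assms(3) by (cases ps) auto
  have kz: "k \<ge> 1" "z ^ N = 1" and qs: "level_index N qs"
    using assms(1) ps by (auto simp: level_index_def)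
  have decay: "\<And>f. f \<in> set (map power_wt qs) \<Longrightarrow> harmonic_decay f"
    using harmonic_decay_power_wt[OF qs assms(2)] .
  show ?thesis
  proof (cases "k \<ge> 2")
    case True
    have "norm (power_wt (k, z) l) \<le> 1 / real l ^ 2" if "l \<ge> 1" for l
      using power_wt_bound[OF True kz(2) assms(2) that] .
    then have "summable (\<lambda>n. norm (power_wt (k, z) n * nested (map power_wt qs) 0 n))"
      by (rule summable_coef_square_decay[OF _ decay])
    then have "summable (\<lambda>n. power_wt (k, z) n * nested (map power_wt qs) 0 n)"
      by (rule summable_norm_cancel)
    moreover have "coef (map power_wt ps) = (\<lambda>n. power_wt (k, z) n * nested (map power_wt qs) 0 n)"
      by (rule ext) (simp add: ps)
    ultimately show ?thesis by simp
  next
    case False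
    then have k: "k = 1" using kz by simp
    then have z: "z \<noteq> 1" "norm z = 1"
      using assms(2,4) kz ps power_eq_1_iff[of z N] by auto
    define A where "A = nested (map power_wt qs) 0"
    obtain D where D: "D \<ge> 0" "\<And>b. b \<ge> 1 \<Longrightarrow> norm (A b) \<le> D * real b powr (1/4)"
      using nested_bound[OF decay] unfolding A_def by metis
    define b where "b = (\<lambda>n. A n / of_nat n)"
    have lim: "b \<longlonglongrightarrow> 0"
    proof (rule Lim_null_comparison)
      show "eventually (\<lambda>n. norm (b n) \<le> D * real n powr (-3/4)) sequentially"
        using eventually_ge_at_top[of 1]
      proof eventually_elim
        case (elim n)
        have "norm (b n) \<le> D * real n powr (1/4) / real n"
          using D(2)[OF elim] by (simp add: b_def norm_divide divide_right_mono)
        also have "\<dots> = D * real n powr (-3/4)"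
          using elim powr_diff[of "real n" "1/4" 1] by simp
        finally show ?case .
      qed
      have "((\<lambda>n. D * real n powr (-3/4)) \<longlongrightarrow> D * 0) sequentially"
        by (intro tendsto_mult tendsto_const tendsto_neg_powr filterlim_real_sequentially) auto
      then show "(\<lambda>n. D * real n powr (-3/4)) \<longlonglongrightarrow> 0" by simp
    qed
    have s1: "summable (\<lambda>n. norm (1 / of_nat (n * Suc n) * A n))"
    proof (unfold A_def, rule summable_coef_square_decay[OF _ decay])
      show "norm (1 / complex_of_nat (l * Suc l)) \<le> 1 / real l ^ 2" if "l \<ge> 1" for l
      proof -
        have "norm (1 / complex_of_nat (l * Suc l)) = 1 / real (l * Suc l)"
          by (simp only: norm_divide norm_one norm_of_nat)
        also have "\<dots> \<le> 1 / real (l ^ 2)"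
          unfolding power2_eq_square using that
          by (intro frac_le of_nat_mono mult_le_mono) auto
        finally show ?thesis by simp
      qed
    qed
    have s2: "summable (\<lambda>n. norm (b (Suc n) - b n))"
    proof -
      \<comment> \<open>\<open>B n\<close> is the increment of the inner nested sum, zero if that sum is empty\<close>
      obtain B where B: "summable (\<lambda>n. norm (B n * 1 / of_nat (Suc n)))"
          "\<And>n. n \<ge> 1 \<Longrightarrow> A (Suc n) = A n + B n"
      proof (cases qs)
        case Nil
        then show ?thesis by (intro that[of "\<lambda>_. 0"]) (auto simp: A_def)
      next
        case (Cons p rs)
        obtain C where C: "C \<ge> 0" "\<And>l. l \<ge> 1 \<Longrightarrow> norm (power_wt p l) \<le> C / real l"
          using decay[of "power_wt p"] Cons by (auto simp: harmonic_decay_def)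
        show ?thesis
        proof (rule that[of "\<lambda>n. power_wt p n * nested (map power_wt rs) 0 n"])
          have "summable (\<lambda>n. norm (power_wt p n / of_nat (Suc n) * nested (map power_wt rs) 0 n))"
          proof (rule summable_coef_square_decay)
            show "norm (power_wt p l / of_nat (Suc l)) \<le> C / (real l)\<^sup>2" if "l \<ge> 1" for l
            proof -
              have "norm (power_wt p l / of_nat (Suc l)) = norm (power_wt p l) / real (Suc l)"
                by (simp add: norm_divide del: of_nat_Suc)
              also have "\<dots> \<le> (C / real l) / real l"
                using C that by (intro frac_le) auto
              finally show ?thesis by (simp add: power2_eq_square)
            qed
          qed (use decay Cons in auto)
          then show "summable (\<lambda>n. norm (power_wt p n * nested (map power_wt rs) 0 n * 1 / of_nat (Suc n)))"
            by (simp add: mult_ac)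
          show "A (Suc n) = A n + power_wt p n * nested (map power_wt rs) 0 n" if "n \<ge> 1" for n
          proof -
            have "{0<..<Suc n} = insert n {0<..<n}" using that by auto
            then show ?thesis by (simp add: A_def Cons)
          qed
        qed
      qed
      have "summable (\<lambda>n. norm (B n * 1 / of_nat (Suc n)) + norm (1 / of_nat (n * Suc n) * A n))"
        by (intro summable_add B(1) s1)
      then show ?thesis
      proof (rule summable_comparison_test')
        fix n :: nat assume n: "n \<ge> 1"
        have "b (Suc n) - b n = B n * 1 / of_nat (Suc n) - 1 / of_nat (n * Suc n) * A n"
        proof -
          define x y where "x = complex_of_nat n" and "y = complex_of_nat (Suc n)"
          have "x \<noteq> 0" "y \<noteq> 0" and y: "y = x + 1"
            using n unfolding x_def y_def of_nat_eq_0_iff by auto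
          then have "(A n + B n) / y - A n / x = B n * 1 / y - 1 / (x * y) * A n"
            by (simp add: divide_simps) (simp add: y algebra_simps)
          then show ?thesis
            using B(2)[OF n] unfolding b_def x_def y_def by (simp only: of_nat_mult)
        qed
        then show "norm (norm (b (Suc n) - b n)) \<le> norm (B n * 1 / of_nat (Suc n)) + norm (1 / of_nat (n * Suc n) * A n)"
          using norm_triangle_ineq4 by auto
      qed
    qed
    have "summable (\<lambda>n. z ^ n * b n)"
      by (rule summable_power_times_bounded_variation[OF _ z(1) lim s2]) (use z in auto)
    moreover have "coef (map power_wt ps) = (\<lambda>n. z ^ n * b n)"
      by (rule ext) (simp add: ps k power_wt_def b_def A_def)
    ultimately show ?thesis by simp
  qed
qed

lemma colored_Li_eq_suminf:
  assumes "level_index N ps" "N > 0" "ps \<noteq> []" "hd ps \<noteq> (1, 1)"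
  shows "colored_Li (map fst ps) (map snd ps) = suminf (coef (map power_wt ps))"
proof -
  have "(\<Sum>ns\<in>{ns \<in> strict_tuples (length (map fst ps)). set ns \<subseteq> {1..M}}.
          \<Prod>j<length (map fst ps). (map snd ps ! j) ^ (ns ! j) / of_nat (ns ! j) ^ (map fst ps ! j))
      = (\<Sum>l\<le>M. coef (map power_wt ps) l)" for M
  proof -
    have "(\<Sum>ns\<in>{ns \<in> strict_tuples (length (map fst ps)). set ns \<subseteq> {1..M}}.
          \<Prod>j<length (map fst ps). (map snd ps ! j) ^ (ns ! j) / of_nat (ns ! j) ^ (map fst ps ! j))
      = (\<Sum>ns\<in>{ns \<in> strict_tuples (length (map power_wt ps)). set ns \<subseteq> {1..M}}.
          \<Prod>j<length (map power_wt ps). (map power_wt ps ! j) (ns ! j))"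
      unfolding length_map by (rule sum.cong[OF refl], rule prod.cong[OF refl]) (simp add: power_wt_def)
    also have "\<dots> = (\<Sum>l\<le>M. coef (map power_wt ps) l)"
      unfolding sum_strict_tuples sum_coef[OF coef_power_wt_0[OF assms(1)]] Suc_eq_plus1 ..
    finally show ?thesis .
  qed
  then show ?thesis
    unfolding colored_Li_def
    by (intro limI) (simp only: summable_LIMSEQ'[OF summable_coef_admissible[OF assms]])
qed

lemma polylog_tendsto_colored_Li:
  assumes "level_index N ps" "N > 0" "ps \<noteq> []" "hd ps \<noteq> (1, 1)"
  shows "((\<lambda>u. polylog ps (of_real u)) \<longlongrightarrow> colored_Li (map fst ps) (map snd ps)) (at_left 1)"
  unfolding polylog_def colored_Li_eq_suminf[OF assms]
  by (rule Abel_limit[OF summable_coef_admissible[OF assms]])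

section \<open>Primitives of rational combinations of polylogarithms\<close>

text \<open>
  The derivative is required only inside the interval, where \<open>du/u\<close> makes sense; continuity at 0
  and the value 0 there still determine the primitive.
\<close>
definition primitive :: "(real \<Rightarrow> complex) \<Rightarrow> (real \<Rightarrow> complex) \<Rightarrow> bool" where
  "primitive G F \<longleftrightarrow> continuous_on {0..<1} F \<and> F 0 = 0 \<and>
     (\<forall>u\<in>{0<..<1}. (F has_vector_derivative G u) (at u))"

lemma primitive_unique:
  assumes F: "primitive G F" and H: "primitive G H" and u: "u \<in> {0..<1}"
  shows "F u = H u"
proof -
  define E where "E = (\<lambda>u. F u - H u)"
  have "E u = 0"
  proof (rule has_derivative_zero_unique_strong_interval[of "{0, u}" 0 u E])
    have "continuous_on {0..<1} E"
      using F H unfolding E_def primitive_def by (intro continuous_on_diff) auto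
    then show "continuous_on {0..u} E"
      by (rule continuous_on_subset) (use u in auto)
    show "E 0 = 0" using F H by (simp add: E_def primitive_def)
    fix v assume v: "v \<in> {0..u} - {0, u}"
    then have "(E has_vector_derivative G v - G v) (at v)"
      using F H u unfolding E_def primitive_def by (intro has_vector_derivative_diff) auto
    then show "(E has_derivative (\<lambda>h. 0)) (at v within {0..u})"
      by (simp add: has_vector_derivative_def has_derivative_at_withinI)
  qed (use u in auto)
  then show ?thesis by (simp add: E_def)
qed

lemma primitive_cong:
  assumes "primitive G F" "\<And>u. u \<in> {0<..<1} \<Longrightarrow> G u = H u"
  shows "primitive H F"
  using assms by (auto simp: primitive_def)

lemma primitive_add: "primitive G F \<Longrightarrow> primitive G' F' \<Longrightarrow> primitive (G + G') (F + F')"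
  unfolding primitive_def plus_fun_def
  by (auto intro!: continuous_on_add has_vector_derivative_add)

lemma primitive_scale: "primitive G F \<Longrightarrow> primitive (\<lambda>u. c * G u) (\<lambda>u. c * F u)"
  unfolding primitive_def
  by (auto intro!: continuous_on_mult_left has_vector_derivative_mult_right)

lemma primitive_polylog:
  assumes "level_index N ps" "N > 0" "ps \<noteq> []"
    and "\<And>u. u \<in> {0<..<1} \<Longrightarrow> (polylog ps has_field_derivative G u) (at (of_real u))"
  shows "primitive G (\<lambda>u. polylog ps (of_real u))"
  unfolding primitive_def
proof (intro conjI ballI)
  show "continuous_on {0..<1} (\<lambda>u. polylog ps (of_real u))"
  proof (rule continuous_at_imp_continuous_on, rule ballI)
    fix u :: real assume "u \<in> {0..<1}"
    then have "isCont (polylog ps) (of_real u)"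
      using polylog_field_differentiable[OF assms(1,2), of "of_real u"]
      by (intro field_differentiable_imp_continuous_at) auto
    then show "isCont (\<lambda>u. polylog ps (of_real u)) u"
      by (rule continuous_at_compose[of u of_real, unfolded o_def, rotated]) (intro continuous_intros)
  qed
  show "polylog ps (of_real 0) = 0"
    using polylog_0[OF assms(1,3)] by simp
  fix u :: real assume "u \<in> {0<..<1}"
  then show "((\<lambda>u. polylog ps (of_real u)) has_vector_derivative G u) (at u)"
    using assms(4) by (intro has_vector_derivative_real_field) auto
qed

global_interpretation rat_fun: vector_space "\<lambda>(q :: rat) (F :: real \<Rightarrow> complex) u. of_rat q * F u"
  by standard (auto simp: algebra_simps of_rat_add of_rat_mult plus_fun_def)

text \<open>
  The flag \<open>adm\<close> restricts to the indices for which the series converges at 1.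
\<close>
definition polylogs :: "nat \<Rightarrow> bool \<Rightarrow> nat \<Rightarrow> (real \<Rightarrow> complex) set" where
  "polylogs N adm w = {\<lambda>u. polylog ps (of_real u) | ps.
     level_index N ps \<and> sum_list (map fst ps) = w \<and> (adm \<longrightarrow> ps \<noteq> [] \<and> hd ps \<noteq> (1, 1))}"

text \<open>
  Taking the limit at 1 is linear over the rationals and sends generators to generators.
\<close>
lemma tendsto_at_one_CMZV:
  assumes "F \<in> rat_fun.span (polylogs N True w)" "N > 0"
  shows "\<exists>c\<in>CMZV N w. (F \<longlongrightarrow> c) (at_left 1)"
  using assms(1)
proof (induction rule: rat_fun.span_induct)
  case base
  show ?case
  proof (rule rat_fun.subspaceI)
    show "0 \<in> {F. \<exists>c\<in>CMZV N w. (F \<longlongrightarrow> c) (at_left 1)}"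
      by (auto simp: CMZV_def zero_fun_def intro!: bexI[of _ 0] rat_complex.span_zero)
    show "F + G \<in> {F. \<exists>c\<in>CMZV N w. (F \<longlongrightarrow> c) (at_left 1)}"
      if FG: "F \<in> {F. \<exists>c\<in>CMZV N w. (F \<longlongrightarrow> c) (at_left 1)}"
        "G \<in> {F. \<exists>c\<in>CMZV N w. (F \<longlongrightarrow> c) (at_left 1)}" for F G
    proof -
      obtain c d where "c \<in> CMZV N w" "d \<in> CMZV N w" "(F \<longlongrightarrow> c) (at_left 1)" "(G \<longlongrightarrow> d) (at_left 1)"
        using FG by auto
      then have "c + d \<in> CMZV N w" "(F + G \<longlongrightarrow> c + d) (at_left 1)"
        by (auto simp: CMZV_def plus_fun_def intro: rat_complex.span_add tendsto_add)
      then show ?thesis by blast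
    qed
    show "(\<lambda>u. of_rat q * F u) \<in> {F. \<exists>c\<in>CMZV N w. (F \<longlongrightarrow> c) (at_left 1)}"
      if F: "F \<in> {F. \<exists>c\<in>CMZV N w. (F \<longlongrightarrow> c) (at_left 1)}" for q F
    proof -
      obtain c where "c \<in> CMZV N w" "(F \<longlongrightarrow> c) (at_left 1)"
        using F by auto
      then have "of_rat q * c \<in> CMZV N w" "((\<lambda>u. of_rat q * F u) \<longlongrightarrow> of_rat q * c) (at_left 1)"
        by (auto simp: CMZV_def intro: rat_complex.span_scale tendsto_mult_left)
      then show ?thesis by blast
    qed
  qed
next
  case (step F)
  then obtain ps where ps: "F = (\<lambda>u. polylog ps (of_real u))" "level_index N ps"
      "sum_list (map fst ps) = w" "ps \<noteq> []" "hd ps \<noteq> (1, 1)"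
    by (auto simp: polylogs_def)
  have "colored_Li (map fst ps) (map snd ps) \<in> colored_mzvs N w"
    unfolding colored_mzvs_def
    using ps by (intro CollectI exI[of _ "map fst ps"] exI[of _ "map snd ps"])
      (auto simp: level_index_def hd_map prod_eq_iff)
  then show ?case
    using polylog_tendsto_colored_Li[OF ps(2) assms(2) ps(4,5)] ps(1)
    by (auto simp: CMZV_def intro: rat_complex.span_base)
qed

text \<open>
  Here \<open>w\<close> is the weight of the primitive. This set is a rational subspace, so closure under
  integration against a form needs to be checked on single polylogarithms only.
\<close>
definition integrable_in :: "nat \<Rightarrow> bool \<Rightarrow> nat \<Rightarrow> (real \<Rightarrow> complex) set" where
  "integrable_in N adm w = {G. \<exists>F\<in>rat_fun.span (polylogs N adm w). primitive G F}"

lemma subspace_integrable_in: "rat_fun.subspace (integrable_in N adm w)"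
proof (rule rat_fun.subspaceI)
  have "primitive 0 0"
    by (auto simp: primitive_def zero_fun_def)
  then show "0 \<in> integrable_in N adm w"
    unfolding integrable_in_def by (blast intro: rat_fun.span_zero)
  show "G + H \<in> integrable_in N adm w" if "G \<in> integrable_in N adm w" "H \<in> integrable_in N adm w" for G H
    using that unfolding integrable_in_def by (blast intro: rat_fun.span_add primitive_add)
  show "(\<lambda>u. of_rat q * G u) \<in> integrable_in N adm w" if "G \<in> integrable_in N adm w" for q G
    using that unfolding integrable_in_def by (blast intro: rat_fun.span_scale primitive_scale)
qed

lemma integrable_in_add:
  assumes "(\<lambda>u. f u * H u) \<in> integrable_in N adm w" "(\<lambda>u. g u * H u) \<in> integrable_in N adm w"
  shows "(\<lambda>u. (f u + g u) * H u) \<in> integrable_in N adm w"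
  using rat_fun.subspace_add[OF subspace_integrable_in assms]
  by (simp add: plus_fun_def distrib_right)

lemma integrable_in_scale:
  assumes "(\<lambda>u. f u * H u) \<in> integrable_in N adm w"
  shows "(\<lambda>u. (of_rat q * f u) * H u) \<in> integrable_in N adm w"
  using rat_fun.subspace_scale[OF subspace_integrable_in assms, of q]
  by (simp add: mult_ac)

lemma integrable_in_extend:
  assumes H: "H \<in> rat_fun.span S"
    and S: "\<And>H. H \<in> S \<Longrightarrow> (\<lambda>u. \<phi> u * H u) \<in> integrable_in N adm w"
  shows "(\<lambda>u. \<phi> u * H u) \<in> integrable_in N adm w"
  using H
proof (induction rule: rat_fun.span_induct)
  case base
  note sub = subspace_integrable_in[of N adm w]
  show ?case
  proof (rule rat_fun.subspaceI)
    show "0 \<in> {H. (\<lambda>u. \<phi> u * H u) \<in> integrable_in N adm w}"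
      using rat_fun.subspace_0[OF sub] by (simp add: zero_fun_def)
    show "H + H' \<in> {H. (\<lambda>u. \<phi> u * H u) \<in> integrable_in N adm w}"
      if "H \<in> {H. (\<lambda>u. \<phi> u * H u) \<in> integrable_in N adm w}"
        "H' \<in> {H. (\<lambda>u. \<phi> u * H u) \<in> integrable_in N adm w}" for H H'
      using rat_fun.subspace_add[OF sub, of "\<lambda>u. \<phi> u * H u" "\<lambda>u. \<phi> u * H' u"] that
      by (simp add: plus_fun_def distrib_left)
    show "(\<lambda>u. of_rat q * H u) \<in> {H. (\<lambda>u. \<phi> u * H u) \<in> integrable_in N adm w}"
      if "H \<in> {H. (\<lambda>u. \<phi> u * H u) \<in> integrable_in N adm w}" for q H
      using rat_fun.subspace_scale[OF sub, of "\<lambda>u. \<phi> u * H u" q] that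
      by (simp add: mult_ac)
  qed
next
  case (step H)
  then show ?case using S by simp
qed

text \<open>
  Positive weight excludes the constant function, whose integral against \<open>du/u\<close> diverges. The new
  first exponent is at least 2, so the result is always admissible.
\<close>
lemma integrable_dlog:
  assumes "H \<in> rat_fun.span (polylogs N False w)" "w > 0" "N > 0"
  shows "(\<lambda>u. (1 / of_real u) * H u) \<in> integrable_in N adm (w + 1)"
proof (rule integrable_in_extend[OF assms(1)])
  fix H assume "H \<in> polylogs N False w"
  then obtain qs where qs: "H = (\<lambda>u. polylog qs (of_real u))" "level_index N qs"
      "sum_list (map fst qs) = w"
    unfolding polylogs_def by auto
  with assms(2) obtain k z ps where "qs = (k, z) # ps"
    by (cases qs) auto
  with qs have H: "H = (\<lambda>u. polylog ((k, z) # ps) (of_real u))"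
      and l: "level_index N ((k, z) # ps)" and w: "k + sum_list (map fst ps) = w"
    by auto
  have l': "level_index N ((Suc k, z) # ps)" and k: "k \<ge> 1"
    using l by (auto simp: level_index_def)
  have "primitive (\<lambda>u. (1 / of_real u) * H u) (\<lambda>u. polylog ((Suc k, z) # ps) (of_real u))"
    unfolding H by (rule primitive_polylog[OF l' assms(3)])
      (use polylog_DERIV_raise[OF l assms(3)] in auto)
  moreover have "(\<lambda>u. polylog ((Suc k, z) # ps) (of_real u)) \<in> polylogs N adm (w + 1)"
    unfolding polylogs_def using l' w k by (intro CollectI exI[of _ "(Suc k, z) # ps"]) auto
  ultimately show "(\<lambda>u. (1 / of_real u) * H u) \<in> integrable_in N adm (w + 1)"
    unfolding integrable_in_def by (blast intro: rat_fun.span_base)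
qed

text \<open>
  The coefficient of \<open>du\<close> in the form \<open>\<omega>\<^sub>\<zeta>\<close>, with its only pole at \<open>1/\<zeta>\<close>.
\<close>
definition letter :: "complex \<Rightarrow> real \<Rightarrow> complex" where
  "letter \<zeta> u = \<zeta> / (1 - \<zeta> * of_real u)"

lemma sum_list_twist: "sum_list (map fst (twist \<zeta> ps)) = sum_list (map fst ps)"
  by (cases ps) auto

text \<open>
  The new leading pair is \<open>(1, \<zeta>)\<close>, so only the letter 1 can spoil admissibility.
\<close>
lemma integrable_letter:
  assumes "H \<in> rat_fun.span (polylogs N False w)" "\<zeta> ^ N = 1" "N > 0" "adm \<Longrightarrow> \<zeta> \<noteq> 1"
  shows "(\<lambda>u. letter \<zeta> u * H u) \<in> integrable_in N adm (w + 1)"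
proof (rule integrable_in_extend[OF assms(1)])
  fix H assume "H \<in> polylogs N False w"
  then obtain ps where H: "H = (\<lambda>u. polylog ps (of_real u))"
      and l: "level_index N ps" and w: "sum_list (map fst ps) = w"
    unfolding polylogs_def by auto
  have l': "level_index N ((1, \<zeta>) # twist \<zeta> ps)"
    using level_index_twist[OF l assms(2)] assms(2) by (auto simp: level_index_def)
  have "primitive (\<lambda>u. letter \<zeta> u * H u) (\<lambda>u. polylog ((1, \<zeta>) # twist \<zeta> ps) (of_real u))"
    unfolding H letter_def by (rule primitive_polylog[OF l' assms(3)])
      (use polylog_DERIV_insert[OF l assms(3,2)] in auto)
  moreover have "(\<lambda>u. polylog ((1, \<zeta>) # twist \<zeta> ps) (of_real u)) \<in> polylogs N adm (w + 1)"
    unfolding polylogs_def using l' w assms(4)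
    by (intro CollectI exI[of _ "(1, \<zeta>) # twist \<zeta> ps"]) (auto simp: sum_list_twist)
  ultimately show "(\<lambda>u. letter \<zeta> u * H u) \<in> integrable_in N adm (w + 1)"
    unfolding integrable_in_def by (blast intro: rat_fun.span_base)
qed

text \<open>
  Equality is asked up to 1 only: \<open>2u/(1 + u\<^sup>2)\<close> is invariant under \<open>u \<mapsto> 1/u\<close>, so beyond 1 its
  composites with power series part from the polylogarithms that they agree with below 1.
\<close>
definition polylog_comb :: "nat \<Rightarrow> bool \<Rightarrow> nat \<Rightarrow> (real \<Rightarrow> complex) \<Rightarrow> bool" where
  "polylog_comb N adm w F \<longleftrightarrow> (\<exists>H\<in>rat_fun.span (polylogs N adm w). \<forall>u\<in>{0..<1}. F u = H u)"

lemma polylog_combI: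
  assumes "primitive G F" "G' \<in> integrable_in N adm w" "\<And>u. u \<in> {0<..<1} \<Longrightarrow> G u = G' u"
  shows "polylog_comb N adm w F"
proof -
  obtain H where H: "H \<in> rat_fun.span (polylogs N adm w)" "primitive G' H"
    using assms(2) by (auto simp: integrable_in_def)
  have "primitive G' F"
    using primitive_cong[OF assms(1,3)] .
  from primitive_unique[OF this H(2)] H(1) show ?thesis
    by (auto simp: polylog_comb_def)
qed

lemma polylog_comb_tendsto:
  assumes "polylog_comb N True w F" "N > 0"
  shows "\<exists>c\<in>CMZV N w. (F \<longlongrightarrow> c) (at_left 1)"
proof -
  obtain H where H: "H \<in> rat_fun.span (polylogs N True w)" "\<And>u. u \<in> {0..<1} \<Longrightarrow> F u = H u"
    using assms by (auto simp: polylog_comb_def)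
  obtain c where c: "c \<in> CMZV N w" "(H \<longlongrightarrow> c) (at_left 1)"
    using tendsto_at_one_CMZV[OF H(1) assms(2)] by auto
  have "eventually (\<lambda>u::real. u \<in> {0<..<1}) (at_left 1)"
    using eventually_at_left_real[of 0 1] by simp
  then have "eventually (\<lambda>u. H u = F u) (at_left 1)"
    by eventually_elim (use H(2) in auto)
  with c show ?thesis
    using tendsto_cong by blast
qed

section \<open>Central binomial coefficients and power series in a square\<close>

definition cbin :: "nat \<Rightarrow> real" where
  "cbin n = real ((2 * n) choose n) / 4 ^ n"

lemma cbin_Suc: "(2 * real n + 2) * cbin (Suc n) = (2 * real n + 1) * cbin n"
proof -
  define N M F B P where "N = real n + 1" and "M = 2 * real n + 1" and "F = (fact n :: real)"
    and "B = (fact (2 * n) :: real)" and "P = (4 ^ n :: real)"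
  have pos: "N \<noteq> 0" "F \<noteq> 0" "P \<noteq> 0" by (auto simp: N_def F_def P_def)
  have "real ((2 * n) choose n) = B / (F * F)"
    unfolding F_def B_def by (subst binomial_fact) (auto simp: mult_2)
  then have 1: "cbin n = B / (F * F) / P"
    by (simp only: cbin_def P_def)
  have "2 * Suc n = Suc (Suc (2 * n))" "2 * Suc n - Suc n = Suc n"
    by simp_all
  then have "real ((2 * Suc n) choose Suc n) = fact (Suc (Suc (2 * n))) / (fact (Suc n) * fact (Suc n))"
    by (subst binomial_fact) (simp, simp only:)
  also have "fact (Suc (Suc (2 * n))) = (2 * N) * (M * B)"
    unfolding fact_Suc by (simp add: N_def M_def B_def add.commute)
  also have "fact (Suc n) = N * F"
    by (simp add: N_def F_def)
  finally have 2: "cbin (Suc n) = (2 * N) * (M * B) / ((N * F) * (N * F)) / (4 * P)"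
    by (simp only: cbin_def P_def power_Suc)
  have "(2 * N) * cbin (Suc n) = M * cbin n"
    unfolding 1 2 using pos by (simp add: field_simps)
  then show ?thesis
    by (simp add: N_def M_def algebra_simps)
qed

lemma cbin_nonneg: "cbin n \<ge> 0"
  by (simp add: cbin_def)

text \<open>
  With \<open>a\<close> and \<open>b\<close> the values at \<open>n\<close> and \<open>n + 1\<close>, the square of the recursion reads
  \<open>c\<^sup>2 b\<^sup>2 = (c - 1)\<^sup>2 a\<^sup>2\<close> with \<open>c = 2n + 2\<close>, and
  \<open>(c - 1)(c + 1) \<le> c\<^sup>2\<close>. The weight \<open>2n + 1\<close> makes the induction close and yields the true order
  \<open>n\<^sup>-\<^sup>1\<^sup>/\<^sup>2\<close>.
\<close>
lemma cbin_square_le: "(cbin n)\<^sup>2 * (2 * real n + 1) \<le> 1"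
proof (induction n)
  case 0
  show ?case by (simp add: cbin_def)
next
  case (Suc n)
  have step: "b\<^sup>2 * (c + 1) \<le> 1"
    if c: "c \<ge> 1" and ab: "c * b = (c - 1) * a" and a: "a\<^sup>2 * (c - 1) \<le> 1" for a b c :: real
  proof -
    have "(a\<^sup>2 * (c - 1)) * ((c - 1) * (c + 1)) \<le> 1 * ((c - 1) * (c + 1))"
      using c by (intro mult_right_mono[OF a]) simp
    moreover have "(a\<^sup>2 * (c - 1)) * ((c - 1) * (c + 1)) = ((c - 1) * a)\<^sup>2 * (c + 1)"
      by (simp only: power2_eq_square mult_ac)
    moreover have "\<dots> = c\<^sup>2 * (b\<^sup>2 * (c + 1))"
      unfolding ab[symmetric] by (simp only: power_mult_distrib mult_ac)
    moreover have "1 * ((c - 1) * (c + 1)) \<le> c\<^sup>2 * 1"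
      by (simp add: power2_eq_square algebra_simps)
    ultimately have "c\<^sup>2 * (b\<^sup>2 * (c + 1)) \<le> c\<^sup>2 * 1"
      by linarith
    then show ?thesis
      by (rule mult_left_le_imp_le) (use c in simp)
  qed
  have e: "2 * real n + 2 - 1 = 2 * real n + 1" "2 * real (Suc n) + 1 = 2 * real n + 2 + 1"
    by (simp_all add: algebra_simps)
  show ?case
    unfolding e by (rule step[of _ _ "cbin n"]) (simp, simp_all only: e cbin_Suc Suc.IH)
qed

lemma cbin_le_1: "cbin n \<le> 1"
proof -
  have "(cbin n)\<^sup>2 * 1 \<le> (cbin n)\<^sup>2 * (2 * real n + 1)"
    by (intro mult_left_mono) auto
  with cbin_square_le[of n] have "(cbin n)\<^sup>2 \<le> 1\<^sup>2" by simp
  then show ?thesis by (rule power2_le_imp_le) simp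
qed

lemma cbin_le_powr: "n \<ge> 1 \<Longrightarrow> cbin n \<le> real n powr (-1/2)"
proof -
  assume n: "n \<ge> 1"
  have "(cbin n)\<^sup>2 * real n \<le> 1"
    by (rule order_trans[OF _ cbin_square_le[of n]]) (intro mult_left_mono, auto)
  then have "(cbin n)\<^sup>2 \<le> 1 / real n"
    using n by (simp add: pos_le_divide_eq)
  also have "\<dots> = (real n powr (-1/2))\<^sup>2"
    using n unfolding power2_eq_square powr_add[symmetric] by (simp add: powr_minus_divide)
  finally show ?thesis by (rule power2_le_imp_le) simp
qed

lemma cbin_powser:
  assumes "\<bar>y\<bar> < 1"
  shows "(\<lambda>n. cbin n * y ^ n) sums (1 / sqrt (1 - y))"
proof -
  have coeff: "(-1/2 gchoose n) * (-1) ^ n = cbin n" for n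
  proof (induction n)
    case (Suc n)
    define G where "G = (\<lambda>n. (-1/2 :: real) gchoose n)"
    have "real (Suc n) * G (Suc n) = (-1/2 - real n) * G n"
      using gbinomial_mult_1[of "-1/2 :: real" n] by (simp add: G_def algebra_simps)
    then have "(- 2 * (-1) ^ n) * (real (Suc n) * G (Suc n)) = (- 2 * (-1) ^ n) * ((-1/2 - real n) * G n)"
      by (simp only:)
    then have "(2 * real n + 2) * (G (Suc n) * (-1) ^ Suc n) = (2 * real n + 1) * (G n * (-1) ^ n)"
      by (simp add: algebra_simps)
    also have "\<dots> = (2 * real n + 2) * cbin (Suc n)"
      using Suc cbin_Suc[of n] by (simp only: G_def)
    finally show ?case
      unfolding G_def by (subst (asm) mult_cancel_left) auto
  qed (simp add: cbin_def)
  have "(\<lambda>n. (-1/2 gchoose n) * (-y) ^ n) sums (1 + - y) powr (-1/2)"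
    using assms by (intro gen_binomial_real) auto
  also have "(\<lambda>n. (-1/2 gchoose n) * (-y) ^ n) = (\<lambda>n. cbin n * y ^ n)"
    by (rule ext) (simp add: power_minus[of y] flip: coeff)
  also have "(1 + - y) powr (-1/2) = 1 / sqrt (1 - y)"
    using assms by (simp add: powr_minus_divide powr_half_sqrt)
  finally show ?thesis .
qed

definition binom_wt :: "nat \<Rightarrow> nat \<Rightarrow> real" where
  "binom_wt k n = cbin n / real n ^ k"

definition odd_wt :: "nat \<Rightarrow> nat \<Rightarrow> real" where
  "odd_wt m n = 1 / (2 * real n - 1) ^ m"

lemma binom_wt_bound:
  assumes "k \<ge> 1" "n \<ge> 1"
  shows "\<bar>binom_wt k n\<bar> \<le> cbin n / real n"
proof -
  have "real n ^ 1 \<le> real n ^ k"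
    using assms by (intro power_increasing) auto
  then have "cbin n / real n ^ k \<le> cbin n / real n"
    using assms cbin_nonneg[of n] by (intro divide_left_mono) auto
  then show ?thesis
    using cbin_nonneg[of n] by (simp add: binom_wt_def)
qed

lemma harmonic_decay_binom_wt: "k \<ge> 1 \<Longrightarrow> harmonic_decay (binom_wt k)"
  unfolding harmonic_decay_def
proof (intro exI[of _ 1] conjI allI impI)
  fix l :: nat assume "k \<ge> 1" "l \<ge> 1"
  have "\<bar>binom_wt k l\<bar> \<le> cbin l / real l" by (rule binom_wt_bound) fact+
  also have "\<dots> \<le> 1 / real l" by (intro divide_right_mono cbin_le_1) auto
  finally show "norm (binom_wt k l) \<le> 1 / real l" by simp
qed simp

lemma odd_wt_bound:
  assumes "m \<ge> r" "l \<ge> 1"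
  shows "norm (odd_wt m l) \<le> 1 / real l ^ r"
proof -
  have "real l ^ r \<le> (2 * real l - 1) ^ r"
    using assms by (intro power_mono) auto
  also have "\<dots> \<le> (2 * real l - 1) ^ m"
    using assms by (intro power_increasing) auto
  finally have "1 / (2 * real l - 1) ^ m \<le> 1 / real l ^ r"
    using assms by (intro divide_left_mono) auto
  moreover have "(2 * real l - 1) ^ m > 0"
    using assms by (intro zero_less_power) auto
  ultimately show ?thesis
    by (simp add: odd_wt_def)
qed

lemma harmonic_decay_odd_wt: "m \<ge> 1 \<Longrightarrow> harmonic_decay (odd_wt m)"
  using odd_wt_bound[of 1 m] by (auto simp: harmonic_decay_def intro!: exI[of _ 1])

lemma norm_square_less_1: "\<bar>x\<bar> < 1 \<Longrightarrow> norm (x\<^sup>2 :: real) < 1"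
  by (simp add: abs_square_less_1)

lemma DERIV_even_powser:
  fixes x :: real
  assumes c: "\<And>n. norm (c n) \<le> C" and x: "\<bar>x\<bar> < 1"
  shows "((\<lambda>x. \<Sum>n. c n * (x\<^sup>2) ^ n) has_field_derivative
    (\<Sum>n. of_nat (Suc n) * c (Suc n) * (x\<^sup>2) ^ n) * (2 * x)) (at x)"
proof (rule DERIV_chain2[where f = "\<lambda>y. \<Sum>n. c n * y ^ n"])
  show "((\<lambda>y. \<Sum>n. c n * y ^ n) has_field_derivative
      (\<Sum>n. of_nat (Suc n) * c (Suc n) * (x\<^sup>2) ^ n)) (at (x\<^sup>2))"
    by (rule DERIV_bounded_powser[where c = c, OF c norm_square_less_1[OF x]])
  show "((\<lambda>x. x\<^sup>2) has_field_derivative 2 * x) (at x)"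
    by (auto intro!: derivative_eq_intros)
qed

text \<open>
  The Euler operator \<open>x d/dx\<close> acts on \<open>x\<^sup>2\<^sup>n\<close> as multiplication by \<open>2n\<close>.
\<close>
lemma DERIV_even_euler:
  fixes x :: real
  assumes c: "\<And>n. norm (c n) \<le> C" and d: "\<And>n. norm (d n) \<le> D"
    and cd: "\<And>n. real (Suc n) * c (Suc n) = d (Suc n)"
    and x: "\<bar>x\<bar> < 1" "x \<noteq> 0"
  shows "((\<lambda>x. \<Sum>n. c n * (x\<^sup>2) ^ n) has_field_derivative
    2 / x * ((\<Sum>n. d n * (x\<^sup>2) ^ n) - d 0)) (at x)"
proof -
  note s = summable_bounded_powser[where c = d, OF d norm_square_less_1[OF x(1)]]
  have "(\<Sum>n. d n * (x\<^sup>2) ^ n) - d 0 = (\<Sum>n. d (Suc n) * (x\<^sup>2) ^ Suc n)"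
    using suminf_split_head[OF s] by simp
  also have "\<dots> = (\<Sum>n. x\<^sup>2 * (of_nat (Suc n) * c (Suc n) * (x\<^sup>2) ^ n))"
    unfolding cd by (simp add: mult_ac)
  also have "\<dots> = x\<^sup>2 * (\<Sum>n. of_nat (Suc n) * c (Suc n) * (x\<^sup>2) ^ n)"
  proof (rule suminf_mult)
    have "summable (\<lambda>n. d (Suc n) * (x\<^sup>2) ^ Suc n)"
      using s by (subst summable_Suc_iff)
    then have "summable (\<lambda>n. x\<^sup>2 * (d (Suc n) * (x\<^sup>2) ^ n))"
      by (simp add: mult_ac)
    then show "summable (\<lambda>n. of_nat (Suc n) * c (Suc n) * (x\<^sup>2) ^ n)"
      unfolding cd using x(2) by (subst (asm) summable_cmult_iff) auto
  qed
  finally have "2 / x * ((\<Sum>n. d n * (x\<^sup>2) ^ n) - d 0) =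
      (\<Sum>n. of_nat (Suc n) * c (Suc n) * (x\<^sup>2) ^ n) * (2 * x)"
    using x(2) by (simp add: power2_eq_square)
  then show ?thesis
    using DERIV_even_powser[where c = c, OF c x(1)] by simp
qed

lemma DERIV_odd_powser:
  fixes x :: real
  assumes c: "\<And>n. norm (c n) \<le> C" and x: "\<bar>x\<bar> < 1"
  shows "((\<lambda>x. x * (\<Sum>n. c n * (x\<^sup>2) ^ n)) has_field_derivative
    (\<Sum>n. (2 * real n + 1) * c n * (x\<^sup>2) ^ n)) (at x)"
proof -
  define y where "y = x\<^sup>2"
  have y: "norm y < 1" using norm_square_less_1[OF x] by (simp add: y_def)
  have s: "summable (\<lambda>n. c n * y ^ n)"
    by (rule summable_bounded_powser[where c = c, OF c y])
  have "norm (real n * c n) \<le> C * real (Suc n)" for n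
  proof -
    have "norm (real n * c n) \<le> real (Suc n) * C"
      unfolding norm_mult using c[of n] by (intro mult_mono) auto
    then show ?thesis by (simp add: mult_ac)
  qed
  then have s2: "summable (\<lambda>n. real n * c n * y ^ n)"
    by (rule summable_linear_growth_powser[OF _ y])
  have s3: "summable (\<lambda>n. real (Suc n) * c (Suc n) * y ^ n)"
  proof (rule summable_linear_growth_powser[OF _ y])
    show "norm (real (Suc n) * c (Suc n)) \<le> C * real (Suc n)" for n
      unfolding norm_mult using mult_left_mono[OF c[of "Suc n"], of "real (Suc n)"] by (simp add: mult_ac)
  qed
  have "(\<Sum>n. (2 * real n + 1) * c n * y ^ n) = (\<Sum>n. c n * y ^ n + 2 * (real n * c n * y ^ n))"
    by (simp add: algebra_simps)
  also have "\<dots> = (\<Sum>n. c n * y ^ n) + 2 * (\<Sum>n. real n * c n * y ^ n)"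
    using s s2 by (subst suminf_add[symmetric]) (auto simp: suminf_mult intro: summable_mult)
  also have "(\<Sum>n. real n * c n * y ^ n) = (\<Sum>n. y * (real (Suc n) * c (Suc n) * y ^ n))"
    using suminf_split_head[OF s2] by (simp add: mult_ac)
  also have "\<dots> = y * (\<Sum>n. real (Suc n) * c (Suc n) * y ^ n)"
    by (rule suminf_mult[OF s3])
  finally have eq: "(\<Sum>n. (2 * real n + 1) * c n * y ^ n) =
      (\<Sum>n. c n * y ^ n) + 2 * (y * (\<Sum>n. real (Suc n) * c (Suc n) * y ^ n))" .
  have "((\<lambda>x. x * (\<Sum>n. c n * (x\<^sup>2) ^ n)) has_field_derivative
     1 * (\<Sum>n. c n * (x\<^sup>2) ^ n) + ((\<Sum>n. of_nat (Suc n) * c (Suc n) * (x\<^sup>2) ^ n) * (2 * x)) * x) (at x)"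
    by (rule DERIV_mult[OF DERIV_ident DERIV_even_powser[where c = c, OF c x]])
  also have "1 * (\<Sum>n. c n * (x\<^sup>2) ^ n) + ((\<Sum>n. of_nat (Suc n) * c (Suc n) * (x\<^sup>2) ^ n) * (2 * x)) * x
      = (\<Sum>n. (2 * real n + 1) * c n * (x\<^sup>2) ^ n)"
    using eq unfolding y_def by (simp add: power2_eq_square mult_ac)
  finally show ?thesis .
qed

section \<open>The rational substitution and the generating functions\<close>

text \<open>
  The rational parametrization of the sine by the tangent of half the angle: with \<open>x = sin \<theta>\<close> and
  \<open>u = tan (\<theta>/2)\<close> also \<open>sqrt (1 - x\<^sup>2) = cos \<theta>\<close> is rational in \<open>u\<close>.
\<close>
definition rat_sin :: "real \<Rightarrow> real" where
  "rat_sin u = 2 * u / (1 + u\<^sup>2)"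

definition rat_sin_deriv :: "real \<Rightarrow> real" where
  "rat_sin_deriv u = 2 * (1 - u\<^sup>2) / (1 + u\<^sup>2)\<^sup>2"

lemma one_plus_square_pos: "1 + u\<^sup>2 > (0::real)"
  by (rule add_pos_nonneg) auto

lemma DERIV_rat_sin: "(rat_sin has_field_derivative rat_sin_deriv u) (at u)"
proof -
  have nz: "1 + u\<^sup>2 \<noteq> 0" using one_plus_square_pos[of u] by simp
  have "(rat_sin has_field_derivative ((2 * 1) * (1 + u\<^sup>2) - (2 * u) * (2 * u)) / ((1 + u\<^sup>2) * (1 + u\<^sup>2))) (at u)"
    unfolding rat_sin_def
    by (rule DERIV_divide) (use nz in \<open>auto intro!: derivative_eq_intros\<close>)
  also have "((2 * 1) * (1 + u\<^sup>2) - (2 * u) * (2 * u)) / ((1 + u\<^sup>2) * (1 + u\<^sup>2)) = rat_sin_deriv u"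
    by (simp add: rat_sin_deriv_def power2_eq_square algebra_simps)
  finally show ?thesis .
qed

lemma one_minus_rat_sin_square: "1 - (rat_sin u)\<^sup>2 = ((1 - u\<^sup>2) / (1 + u\<^sup>2))\<^sup>2"
proof -
  have nz: "1 + u\<^sup>2 \<noteq> 0" using one_plus_square_pos[of u] by simp
  have "1 - (rat_sin u)\<^sup>2 = ((1 + u\<^sup>2)\<^sup>2 - (2 * u)\<^sup>2) / (1 + u\<^sup>2)\<^sup>2"
    using nz by (simp add: rat_sin_def power_divide diff_divide_distrib)
  also have "(1 + u\<^sup>2)\<^sup>2 - (2 * u)\<^sup>2 = (1 - u\<^sup>2)\<^sup>2"
    by (simp add: power2_eq_square algebra_simps)
  finally show ?thesis by (simp add: power_divide)
qed

lemma square_less_1: "0 < u \<Longrightarrow> u < 1 \<Longrightarrow> u\<^sup>2 < (1::real)"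
  using power_strict_mono[of u 1 2] by simp

lemma rat_sin_in_unit:
  assumes "u \<in> {0<..<1}"
  shows "rat_sin u \<in> {0<..<1}"
proof -
  have "0 < (1 - u)\<^sup>2" using assms by simp
  then have "2 * u < 1 + u\<^sup>2" by (simp add: power2_eq_square algebra_simps)
  then show ?thesis
    using assms one_plus_square_pos[of u] by (simp add: rat_sin_def)
qed

lemma rat_sin_0 [simp]: "rat_sin 0 = 0"
  by (simp add: rat_sin_def)

lemma rat_sin_deriv_div:
  assumes "u \<noteq> 0"
  shows "rat_sin_deriv u / rat_sin u = (1 - u\<^sup>2) / (u * (1 + u\<^sup>2))"
proof -
  have "(2 * p / q\<^sup>2) / (2 * u / q) = p / (u * q)" if "q \<noteq> 0" for p q
    using assms that by (simp add: power2_eq_square divide_simps)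
  then show ?thesis
    unfolding rat_sin_deriv_def rat_sin_def using one_plus_square_pos[of u] by (metis less_irrefl)
qed

lemma dlog_rat_sin:
  assumes "u \<noteq> 0"
  shows "rat_sin_deriv u / rat_sin u = 1 / u + - 2 * u / (1 + u\<^sup>2)"
proof -
  define q where "q = 1 + u\<^sup>2"
  have q: "q \<noteq> 0" using one_plus_square_pos[of u] by (simp add: q_def)
  have "1 - u\<^sup>2 = q - 2 * u * u"
    by (simp add: q_def power2_eq_square)
  moreover have "(q - 2 * u * u) / (u * q) = 1 / u + - 2 * u / q"
    using assms q by (simp add: divide_simps)
  ultimately show ?thesis
    unfolding rat_sin_deriv_div[OF assms] q_def[symmetric] by simp
qed

lemma rat_sin_deriv_div_one_minus_square:
  assumes "u \<in> {0<..<1}"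
  shows "rat_sin_deriv u / (1 - (rat_sin u)\<^sup>2) = 2 / (1 - u\<^sup>2)"
proof -
  have "1 - u\<^sup>2 \<noteq> 0" "1 + u\<^sup>2 \<noteq> 0"
    using assms square_less_1[of u] one_plus_square_pos[of u] by auto
  moreover have "(2 * p / q\<^sup>2) / (p\<^sup>2 / q\<^sup>2) = 2 / p" if "p \<noteq> 0" "q \<noteq> 0" for p q :: real
    using that by (simp add: power2_eq_square)
  ultimately show ?thesis
    unfolding one_minus_rat_sin_square rat_sin_deriv_def power_divide by blast
qed

lemma rat_sin_times_deriv_div_one_minus_square:
  assumes "u \<in> {0<..<1}"
  shows "rat_sin u * rat_sin_deriv u / (1 - (rat_sin u)\<^sup>2) = 2 * u / (1 - u\<^sup>2) + 2 * u / (1 + u\<^sup>2)"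
proof -
  have nz: "1 - u\<^sup>2 \<noteq> 0" "1 + u\<^sup>2 \<noteq> 0"
    using assms square_less_1[of u] one_plus_square_pos[of u] by auto
  have "2 * u / (1 - u\<^sup>2) + 2 * u / (1 + u\<^sup>2) =
      (2 * u * (1 + u\<^sup>2) + 2 * u * (1 - u\<^sup>2)) / ((1 - u\<^sup>2) * (1 + u\<^sup>2))"
    using nz by (rule add_frac_eq)
  also have "2 * u * (1 + u\<^sup>2) + 2 * u * (1 - u\<^sup>2) = 2 * u * 2"
    by (simp add: algebra_simps)
  also have "2 * u * 2 / ((1 - u\<^sup>2) * (1 + u\<^sup>2)) = rat_sin u * (2 / (1 - u\<^sup>2))"
    by (simp add: rat_sin_def)
  also have "\<dots> = rat_sin u * rat_sin_deriv u / (1 - (rat_sin u)\<^sup>2)"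
    unfolding rat_sin_deriv_div_one_minus_square[OF assms, symmetric] by simp
  finally show ?thesis ..
qed

lemma letter_imaginary:
  "letter \<i> u + letter (- \<i>) u = of_real (- 2 * u / (1 + u\<^sup>2))"
proof -
  define v where "v = complex_of_real u"
  have prod: "(1 - \<i> * v) * (1 + \<i> * v) = 1 + v\<^sup>2"
    by (simp add: power2_eq_square algebra_simps)
  have "1 + v\<^sup>2 = of_real (1 + u\<^sup>2)" by (simp add: v_def)
  then have "1 + v\<^sup>2 \<noteq> 0"
    using one_plus_square_pos[of u] by (metis less_irrefl of_real_eq_0_iff)
  then have nz: "1 - \<i> * v \<noteq> 0" "1 + \<i> * v \<noteq> 0"
    using prod by auto
  have "letter \<i> u + letter (- \<i>) u = \<i> / (1 - \<i> * v) - \<i> / (1 + \<i> * v)"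
    by (simp add: letter_def v_def)
  also have "\<dots> = (\<i> * (1 + \<i> * v) - \<i> * (1 - \<i> * v)) / ((1 - \<i> * v) * (1 + \<i> * v))"
    using nz by (subst diff_frac_eq) auto
  also have "\<dots> = - 2 * v / (1 + v\<^sup>2)"
    unfolding prod by (simp add: algebra_simps)
  finally show ?thesis by (simp add: v_def)
qed

lemma letter_real:
  assumes "u \<in> {0<..<1}"
  shows "letter 1 u + of_rat (- 1) * letter (- 1) u = of_real (2 / (1 - u\<^sup>2))"
    and "letter 1 u + letter (- 1) u = of_real (2 * u / (1 - u\<^sup>2))"
proof -
  have 1: "letter 1 u = of_real (1 / (1 - u))" "letter (- 1) u = of_real (- 1 / (1 + u))"
    by (simp_all add: letter_def)
  have nz: "1 - u \<noteq> 0" "1 + u \<noteq> 0" and p: "1 - u\<^sup>2 = (1 - u) * (1 + u)"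
    using assms by (auto simp: power2_eq_square algebra_simps)
  have "1 / (1 - u) - - 1 / (1 + u) = 2 / (1 - u\<^sup>2)"
    unfolding p using nz by (simp add: divide_simps)
  then show "letter 1 u + of_rat (- 1) * letter (- 1) u = of_real (2 / (1 - u\<^sup>2))"
    unfolding 1 by (metis of_rat_minus of_rat_1 mult_minus1 of_real_minus of_real_add diff_conv_add_uminus)
  have "1 / (1 - u) + - 1 / (1 + u) = 2 * u / (1 - u\<^sup>2)"
    unfolding p using nz by (simp add: divide_simps)
  then show "letter 1 u + letter (- 1) u = of_real (2 * u / (1 - u\<^sup>2))"
    unfolding 1 by (metis of_real_add)
qed

text \<open>
  The transfer principle from the variable \<open>x\<close> to \<open>u\<close>: a function of \<open>x\<close> whose derivative, pulled
  back to \<open>u\<close>, has a primitive in the span must itself be that primitive.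
\<close>
lemma polylog_comb_chain:
  fixes F F' :: "real \<Rightarrow> real"
  assumes cont: "\<And>x. x \<in> {0..<1} \<Longrightarrow> isCont F x" and F0: "F 0 = 0"
    and deriv: "\<And>x. x \<in> {0<..<1} \<Longrightarrow> (F has_field_derivative F' x) (at x)"
    and G: "G \<in> integrable_in N adm w"
    and eq: "\<And>u. u \<in> {0<..<1} \<Longrightarrow> of_real (F' (rat_sin u) * rat_sin_deriv u) = G u"
  shows "polylog_comb N adm w (\<lambda>u. of_real (F (rat_sin u)))"
proof (rule polylog_combI[OF _ G eq])
  show "primitive (\<lambda>u. of_real (F' (rat_sin u) * rat_sin_deriv u)) (\<lambda>u. of_real (F (rat_sin u)))"
    unfolding primitive_def
  proof (intro conjI ballI)
    show "continuous_on {0..<1} (\<lambda>u. complex_of_real (F (rat_sin u)))"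
    proof (intro continuous_on_of_real continuous_at_imp_continuous_on ballI)
      fix u :: real assume u: "u \<in> {0..<1}"
      then have "rat_sin u \<in> {0..<1}"
        using rat_sin_in_unit[of u] by (cases "u = 0") auto
      then show "isCont (\<lambda>u. F (rat_sin u)) u"
        using DERIV_isCont[OF DERIV_rat_sin] cont by (intro isCont_o2[of u rat_sin F]) auto
    qed
    show "complex_of_real (F (rat_sin 0)) = 0" using F0 by simp
    fix u :: real assume u: "u \<in> {0<..<1}"
    show "((\<lambda>u. complex_of_real (F (rat_sin u))) has_vector_derivative of_real (F' (rat_sin u) * rat_sin_deriv u)) (at u)"
      by (intro has_vector_derivative_of_real DERIV_chain2[OF deriv DERIV_rat_sin] rat_sin_in_unit u)
  qed
qed

text \<open>
  The generating function of the innermost binomial sum has even powers of \<open>x\<close>, every later one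
  odd powers, with \<open>n\<close> attached to \<open>2n\<close> and to \<open>2n - 1\<close> respectively. The index shift in the odd
  series keeps it free of negative exponents and makes it visibly continuous at 0.
\<close>
definition even_series :: "nat \<Rightarrow> real \<Rightarrow> real" where
  "even_series k x = (\<Sum>n. binom_wt k n * (x\<^sup>2) ^ n)"

definition odd_series :: "(nat \<Rightarrow> real) list \<Rightarrow> real \<Rightarrow> real" where
  "odd_series fs x = x * (\<Sum>n. coef fs (Suc n) * (x\<^sup>2) ^ n)"

lemma polylog_comb_obtain:
  assumes "polylog_comb N adm w F"
  obtains H where "H \<in> rat_fun.span (polylogs N adm w)" "\<And>u. u \<in> {0<..<1} \<Longrightarrow> F u = H u"
  using assms by (auto simp: polylog_comb_def)

lemma binom_wt_le_1: "norm (binom_wt k n) \<le> 1"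
proof -
  have "cbin n / real n ^ k \<le> cbin n / 1" if "n \<noteq> 0"
    using that cbin_nonneg[of n] by (intro divide_left_mono) auto
  then have "cbin n / real n ^ k \<le> 1" if "n \<noteq> 0"
    using that cbin_le_1[of n] by (auto intro: order_trans)
  then have "cbin n / real n ^ k \<le> 1"
    by (cases "n = 0"; cases "k = 0") (auto simp: cbin_le_1 power_0_left)
  then show ?thesis
    using cbin_nonneg[of n] by (simp add: binom_wt_def)
qed

lemma isCont_even_series: "x \<in> {0..<1} \<Longrightarrow> isCont (even_series k) x"
  unfolding even_series_def[abs_def]
  by (rule DERIV_isCont[OF DERIV_even_powser[where c = "binom_wt k", OF binom_wt_le_1]]) auto

lemma even_series_0: "k \<ge> 1 \<Longrightarrow> even_series k 0 = 0"
  using powser_zero[of "binom_wt k"] by (simp add: even_series_def binom_wt_def)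

lemma dlog_in_letters:
  assumes "u \<in> {0<..<1}"
  shows "1 / of_real u + (letter \<i> u + letter (- \<i>) u) = of_real (rat_sin_deriv u / rat_sin u)"
proof -
  have "rat_sin_deriv u / rat_sin u = 1 / u + - 2 * u / (1 + u\<^sup>2)"
    using assms by (intro dlog_rat_sin) auto
  then show ?thesis
    unfolding letter_imaginary by (simp only: of_real_add of_real_divide of_real_1)
qed

text \<open>
  The form \<open>dx/x\<close> contains no letter 1, hence leads to admissible indices.
\<close>
lemma integrable_dlog_rat_sin:
  assumes "H \<in> rat_fun.span (polylogs 4 False w)" "w > 0"
  shows "(\<lambda>u. (1 / of_real u + (letter \<i> u + letter (- \<i>) u)) * H u) \<in> integrable_in 4 adm (w + 1)"
  by (intro integrable_in_add integrable_dlog integrable_letter assms)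
    (auto simp: power_numeral_reduce complex_eq_iff)

text \<open>
  For \<open>k = 1\<close> the derivative is known in closed form by the binomial series; after the substitution
  it is a combination of the letters \<open>\<i>\<close> and \<open>-\<i>\<close>. Each further factor \<open>1/n\<close> is an integration
  against \<open>2 dx/x\<close>.
\<close>
lemma even_series_comb:
  assumes "k \<ge> 1"
  shows "polylog_comb 4 False k (\<lambda>u. of_real (even_series k (rat_sin u)))"
  using assms
proof (induction k rule: nat_induct_at_least)
  case base
  define F' where "F' = (\<lambda>x. 2 / x * ((\<Sum>n. binom_wt 0 n * (x\<^sup>2) ^ n) - binom_wt 0 0))"
  have one: "(\<lambda>u. 1) \<in> rat_fun.span (polylogs 4 False 0)"
  proof (rule rat_fun.span_base)
    have "polylog [] u = 1" for u
      unfolding polylog_def by (subst suminf_finite[of "{0}"]) auto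
    then show "(\<lambda>u. 1) \<in> polylogs 4 False 0"
      unfolding polylogs_def by (intro CollectI exI[of _ "[]"]) (auto simp: level_index_def)
  qed
  have "(\<lambda>u. (of_rat (- 2) * (letter \<i> u + letter (- \<i>) u)) * 1) \<in> integrable_in 4 False (0 + 1)"
    by (intro integrable_in_scale integrable_in_add integrable_letter one)
      (auto simp: power_numeral_reduce complex_eq_iff)
  then show ?case
  proof (intro polylog_comb_chain[where F' = F' and F = "even_series 1"])
    show "(even_series 1 has_field_derivative F' x) (at x)" if "x \<in> {0<..<1}" for x
      unfolding even_series_def[abs_def] F'_def
      by (rule DERIV_even_euler[where c = "binom_wt 1" and d = "binom_wt 0", OF binom_wt_le_1 binom_wt_le_1])
        (use that in \<open>auto simp: binom_wt_def\<close>)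
    fix u :: real assume u: "u \<in> {0<..<1}"
    define x where "x = rat_sin u"
    have x: "0 < x" "x < 1" using rat_sin_in_unit[OF u] by (auto simp: x_def)
    have u2: "1 - u\<^sup>2 > 0" using u square_less_1[of u] by simp
    have "(\<Sum>n. binom_wt 0 n * (x\<^sup>2) ^ n) = 1 / sqrt (1 - x\<^sup>2)"
      using cbin_powser[of "x\<^sup>2"] square_less_1[OF x] by (simp add: sums_iff binom_wt_def)
    also have "sqrt (1 - x\<^sup>2) = (1 - u\<^sup>2) / (1 + u\<^sup>2)"
      unfolding x_def one_minus_rat_sin_square
      using u2 one_plus_square_pos[of u] by (intro real_sqrt_unique) auto
    finally have sum: "(\<Sum>n. binom_wt 0 n * (x\<^sup>2) ^ n) = (1 + u\<^sup>2) / (1 - u\<^sup>2)"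
      by simp
    have "F' x * rat_sin_deriv u = 2 * ((1 + u\<^sup>2) / (1 - u\<^sup>2) - 1) * (rat_sin_deriv u / x)"
    proof -
      have "binom_wt 0 0 = 1" by (simp add: binom_wt_def cbin_def)
      then show ?thesis unfolding F'_def sum by simp
    qed
    also have "(1 + u\<^sup>2) / (1 - u\<^sup>2) - 1 = 2 * u\<^sup>2 / (1 - u\<^sup>2)"
      using u2 by (simp add: field_simps)
    also have "rat_sin_deriv u / x = (1 - u\<^sup>2) / (u * (1 + u\<^sup>2))"
      unfolding x_def using u by (intro rat_sin_deriv_div) auto
    also have "2 * (2 * u\<^sup>2 / (1 - u\<^sup>2)) * ((1 - u\<^sup>2) / (u * (1 + u\<^sup>2))) = - 2 * (- 2 * u / (1 + u\<^sup>2))"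
      using u u2 by (simp add: power2_eq_square)
    finally show "complex_of_real (F' (rat_sin u) * rat_sin_deriv u) = of_rat (- 2) * (letter \<i> u + letter (- \<i>) u) * 1"
      unfolding letter_imaginary x_def by (simp add: of_rat_minus)
  qed (use isCont_even_series even_series_0 in auto)
next
  case (Suc k)
  obtain H where H: "H \<in> rat_fun.span (polylogs 4 False k)"
      "\<And>u. u \<in> {0<..<1} \<Longrightarrow> complex_of_real (even_series k (rat_sin u)) = H u"
    using polylog_comb_obtain[OF Suc.IH] by blast
  define F' where "F' = (\<lambda>x. 2 / x * ((\<Sum>n. binom_wt k n * (x\<^sup>2) ^ n) - binom_wt k 0))"
  have "(\<lambda>u. (of_rat 2 * (1 / of_real u + (letter \<i> u + letter (- \<i>) u))) * H u) \<in> integrable_in 4 False (k + 1)"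
    using Suc.hyps by (intro integrable_in_scale integrable_dlog_rat_sin H) auto
  then show ?case
    unfolding Suc_eq_plus1
  proof (intro polylog_comb_chain[where F' = F' and F = "even_series (k + 1)"])
    show "(even_series (k + 1) has_field_derivative F' x) (at x)" if "x \<in> {0<..<1}" for x
      unfolding even_series_def[abs_def] F'_def
      by (rule DERIV_even_euler[where c = "binom_wt (k + 1)" and d = "binom_wt k", OF binom_wt_le_1 binom_wt_le_1])
        (use that in \<open>auto simp: binom_wt_def\<close>)
    fix u :: real assume u: "u \<in> {0<..<1}"
    have "F' (rat_sin u) * rat_sin_deriv u = 2 * (rat_sin_deriv u / rat_sin u) * even_series k (rat_sin u)"
      using Suc.hyps by (simp add: F'_def even_series_def binom_wt_def)
    then show "complex_of_real (F' (rat_sin u) * rat_sin_deriv u) =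
        of_rat 2 * (1 / of_real u + (letter \<i> u + letter (- \<i>) u)) * H u"
      unfolding dlog_in_letters[OF u] H(2)[OF u, symmetric] by simp
  qed (use isCont_even_series even_series_0 in auto)
qed

lemma isCont_odd_series:
  assumes "\<And>f. f \<in> set fs \<Longrightarrow> harmonic_decay f" "x \<in> {0..<1}"
  shows "isCont (odd_series fs) x"
proof -
  obtain C where C: "\<And>n. norm (coef fs n) \<le> C"
    using coef_bounded[OF assms(1)] by blast
  show ?thesis
    unfolding odd_series_def[abs_def]
    by (rule DERIV_isCont[OF DERIV_odd_powser[where c = "\<lambda>n. coef fs (Suc n)", OF C]])
      (use assms(2) in auto)
qed

lemma odd_series_0: "odd_series fs 0 = 0"
  by (simp add: odd_series_def)

lemma odd_wt_Suc: "odd_wt m (Suc n) = 1 / (2 * real n + 1) ^ m"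
  by (simp add: odd_wt_def add.commute)

text \<open>
  A further factor \<open>1/(2n - 1)\<close> is an integration against \<open>dx/x\<close>.
\<close>
lemma odd_series_comb_raise:
  assumes m: "m \<ge> 1" and fs: "\<And>f. f \<in> set fs \<Longrightarrow> harmonic_decay f"
    and comb: "polylog_comb 4 False w (\<lambda>u. of_real (odd_series (odd_wt m # fs) (rat_sin u)))" and w: "w > 0"
  shows "polylog_comb 4 adm (w + 1) (\<lambda>u. of_real (odd_series (odd_wt (Suc m) # fs) (rat_sin u)))"
proof -
  obtain H where H: "H \<in> rat_fun.span (polylogs 4 False w)"
      "\<And>u. u \<in> {0<..<1} \<Longrightarrow> complex_of_real (odd_series (odd_wt m # fs) (rat_sin u)) = H u"
    using polylog_comb_obtain[OF comb] by blast
  have decay: "\<And>f. f \<in> set (odd_wt (Suc m) # fs) \<Longrightarrow> harmonic_decay f"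
    using fs harmonic_decay_odd_wt[of "Suc m"] by auto
  obtain C where C: "\<And>n. norm (coef (odd_wt (Suc m) # fs) n) \<le> C"
    using coef_bounded[OF decay] by blast
  define F' where "F' = (\<lambda>x. \<Sum>n. (2 * real n + 1) * coef (odd_wt (Suc m) # fs) (Suc n) * (x\<^sup>2) ^ n)"
  have G: "(\<lambda>u. (1 / of_real u + (letter \<i> u + letter (- \<i>) u)) * H u) \<in> integrable_in 4 adm (w + 1)"
    by (intro integrable_dlog_rat_sin H w)
  show ?thesis
  proof (rule polylog_comb_chain[where F' = F' and F = "odd_series (odd_wt (Suc m) # fs)", OF _ odd_series_0 _ G])
    show "isCont (odd_series (odd_wt (Suc m) # fs)) x" if "x \<in> {0..<1}" for x
      by (rule isCont_odd_series[OF decay that])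
    show "(odd_series (odd_wt (Suc m) # fs) has_field_derivative F' x) (at x)" if "x \<in> {0<..<1}" for x
      unfolding odd_series_def[abs_def] F'_def
      by (rule DERIV_odd_powser[where c = "\<lambda>n. coef (odd_wt (Suc m) # fs) (Suc n)", OF C])
        (use that in auto)
    fix u :: real assume u: "u \<in> {0<..<1}"
    have "F' (rat_sin u) = (\<Sum>n. coef (odd_wt m # fs) (Suc n) * ((rat_sin u)\<^sup>2) ^ n)"
    proof -
      have "(2 * real n + 1) * coef (odd_wt (Suc m) # fs) (Suc n) = coef (odd_wt m # fs) (Suc n)" for n
        using of_nat_0_le_iff[of n, where 'a = real] by (simp add: odd_wt_Suc)
      then show ?thesis unfolding F'_def by (simp only:)
    qed
    then have "F' (rat_sin u) * rat_sin_deriv u = (rat_sin_deriv u / rat_sin u) * odd_series (odd_wt m # fs) (rat_sin u)"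
      using rat_sin_in_unit[OF u] by (simp add: odd_series_def)
    then show "complex_of_real (F' (rat_sin u) * rat_sin_deriv u) = (1 / of_real u + (letter \<i> u + letter (- \<i>) u)) * H u"
      unfolding dlog_in_letters[OF u] H(2)[OF u, symmetric] by simp
  qed
qed

text \<open>
  A new odd variable is an integration against \<open>dx/(1 - x\<^sup>2)\<close>, since \<open>1/(1 - x\<^sup>2)\<close> forms partial sums
  of coefficients in the variable \<open>x\<^sup>2\<close>. The assumptions leave open how the inner series looks in \<open>u\<close>,
  because it is even for the first odd variable and odd later on.
\<close>
lemma odd_series_comb_insert:
  assumes fs: "\<And>f. f \<in> set fs \<Longrightarrow> harmonic_decay f" and fs0: "coef fs 0 = 0"
    and G: "G \<in> integrable_in 4 False w"
    and G_eq: "\<And>u. u \<in> {0<..<1} \<Longrightarrow>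
        of_real ((\<Sum>n. coef fs n * ((rat_sin u)\<^sup>2) ^ n) * (rat_sin_deriv u / (1 - (rat_sin u)\<^sup>2))) = G u"
  shows "polylog_comb 4 False w (\<lambda>u. of_real (odd_series (odd_wt 1 # fs) (rat_sin u)))"
proof -
  have decay: "\<And>f. f \<in> set (odd_wt 1 # fs) \<Longrightarrow> harmonic_decay f"
    using fs harmonic_decay_odd_wt[of 1] by auto
  obtain C where C: "\<And>n. norm (coef (odd_wt 1 # fs) n) \<le> C"
    using coef_bounded[OF decay] by blast
  obtain C' where C': "\<And>n. norm (coef fs n) \<le> C'"
    using coef_bounded[OF fs] by blast
  define F' where "F' = (\<lambda>x. \<Sum>n. (2 * real n + 1) * coef (odd_wt 1 # fs) (Suc n) * (x\<^sup>2) ^ n)"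
  show ?thesis
  proof (rule polylog_comb_chain[where F' = F' and F = "odd_series (odd_wt 1 # fs)", OF _ odd_series_0 _ G])
    show "isCont (odd_series (odd_wt 1 # fs)) x" if "x \<in> {0..<1}" for x
      by (rule isCont_odd_series[OF decay that])
    show "(odd_series (odd_wt 1 # fs) has_field_derivative F' x) (at x)" if "x \<in> {0<..<1}" for x
      unfolding odd_series_def[abs_def] F'_def
      by (rule DERIV_odd_powser[where c = "\<lambda>n. coef (odd_wt 1 # fs) (Suc n)", OF C])
        (use that in auto)
    fix u :: real assume u: "u \<in> {0<..<1}"
    have "F' (rat_sin u) = (\<Sum>n. (\<Sum>l\<le>n. coef fs l) * ((rat_sin u)\<^sup>2) ^ n)"
    proof -
      have "(2 * real n + 1) * coef (odd_wt 1 # fs) (Suc n) = (\<Sum>l\<le>n. coef fs l)" for n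
        using of_nat_0_le_iff[of n, where 'a = real] sum_coef[of fs n] fs0 by (simp add: odd_wt_Suc)
      then show ?thesis unfolding F'_def by (simp only:)
    qed
    also have "\<dots> = (\<Sum>n. coef fs n * ((rat_sin u)\<^sup>2) ^ n) / (1 - (rat_sin u)\<^sup>2)"
      using rat_sin_in_unit[OF u] by (intro powser_partial_sums[where c = "coef fs", OF C'] norm_square_less_1) auto
    finally show "complex_of_real (F' (rat_sin u) * rat_sin_deriv u) = G u"
      unfolding G_eq[OF u, symmetric] by simp
  qed
qed

text \<open>
  The inner series, written in powers of \<open>x\<^sup>2\<close>, is the even series itself for the first odd variable
  and \<open>x\<close> times the odd series afterwards. Hence the form is \<open>dx/(1 - x\<^sup>2)\<close> in the base case and
  \<open>x dx/(1 - x\<^sup>2)\<close> in the induction step.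
\<close>
lemma odd_series_comb:
  assumes "k \<ge> 1" "\<And>m. m \<in> set (m0 # ms) \<Longrightarrow> m \<ge> 1"
  shows "polylog_comb 4 False (sum_list (m0 # ms) + k)
           (\<lambda>u. of_real (odd_series (map odd_wt (m0 # ms) @ [binom_wt k]) (rat_sin u)))"
  using assms(2)
proof (induction ms arbitrary: m0)
  case Nil
  have decay: "\<And>f. f \<in> set [binom_wt k] \<Longrightarrow> harmonic_decay f"
    using harmonic_decay_binom_wt[OF assms(1)] by auto
  have "m0 \<ge> 1" using Nil by auto
  then show ?case
  proof (induction m0 rule: nat_induct_at_least)
    case base
    obtain H where H: "H \<in> rat_fun.span (polylogs 4 False k)"
        "\<And>u. u \<in> {0<..<1} \<Longrightarrow> complex_of_real (even_series k (rat_sin u)) = H u"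
      using polylog_comb_obtain[OF even_series_comb[OF assms(1)]] by blast
    have G: "(\<lambda>u. (letter 1 u + of_rat (- 1) * letter (- 1) u) * H u) \<in> integrable_in 4 False (k + 1)"
      by (intro integrable_in_add integrable_in_scale integrable_letter H) auto
    have "polylog_comb 4 False (k + 1) (\<lambda>u. of_real (odd_series (odd_wt 1 # [binom_wt k]) (rat_sin u)))"
    proof (rule odd_series_comb_insert[OF decay _ G])
      show "coef [binom_wt k] 0 = 0" using assms(1) by (simp add: binom_wt_def)
      show "complex_of_real ((\<Sum>n. coef [binom_wt k] n * ((rat_sin u)\<^sup>2) ^ n) * (rat_sin_deriv u / (1 - (rat_sin u)\<^sup>2))) =
          (letter 1 u + of_rat (- 1) * letter (- 1) u) * H u" if u: "u \<in> {0<..<1}" for u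
        unfolding letter_real(1)[OF u] H(2)[OF u, symmetric] rat_sin_deriv_div_one_minus_square[OF u] by (simp add: even_series_def)
    qed
    then show ?case by (simp add: add.commute)
  next
    case (Suc m)
    then show ?case
      using odd_series_comb_raise[where fs = "[binom_wt k]", OF Suc.hyps decay, where w = "m + k" and adm = False] by simp
  qed
next
  case (Cons m1 ms)
  define fs where "fs = map odd_wt (m1 # ms) @ [binom_wt k]"
  have decay: "\<And>f. f \<in> set fs \<Longrightarrow> harmonic_decay f"
    using harmonic_decay_binom_wt[OF assms(1)] harmonic_decay_odd_wt Cons.prems by (auto simp: fs_def)
  define w where "w = sum_list (m1 # ms) + k"
  have IH: "polylog_comb 4 False w (\<lambda>u. of_real (odd_series fs (rat_sin u)))"
    unfolding w_def fs_def using Cons.prems by (intro Cons.IH) auto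
  have "m0 \<ge> 1" using Cons.prems by auto
  then have "polylog_comb 4 False (m0 + w) (\<lambda>u. of_real (odd_series (odd_wt m0 # fs) (rat_sin u)))"
  proof (induction m0 rule: nat_induct_at_least)
    case base
    obtain H where H: "H \<in> rat_fun.span (polylogs 4 False w)"
        "\<And>u. u \<in> {0<..<1} \<Longrightarrow> complex_of_real (odd_series fs (rat_sin u)) = H u"
      using polylog_comb_obtain[OF IH] by blast
    have G: "(\<lambda>u. ((letter 1 u + letter (- 1) u) + of_rat (- 1) * (letter \<i> u + letter (- \<i>) u)) * H u)
        \<in> integrable_in 4 False (w + 1)"
      by (intro integrable_in_add integrable_in_scale integrable_letter H)
        (auto simp: power_numeral_reduce complex_eq_iff)
    have fs0: "coef fs 0 = 0"
      by (cases "map odd_wt ms @ [binom_wt k]") (auto simp: fs_def)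
    obtain C where C: "\<And>n. norm (coef fs n) \<le> C"
      using coef_bounded[OF decay] by blast
    have "polylog_comb 4 False (w + 1) (\<lambda>u. of_real (odd_series (odd_wt 1 # fs) (rat_sin u)))"
    proof (rule odd_series_comb_insert[OF decay fs0 G])
      fix u :: real assume u: "u \<in> {0<..<1}"
      define x where "x = rat_sin u"
      have x: "norm (x\<^sup>2) < 1"
        using rat_sin_in_unit[OF u] by (intro norm_square_less_1) (auto simp: x_def)
      have s: "summable (\<lambda>n. coef fs n * (x\<^sup>2) ^ n)"
        by (rule summable_bounded_powser[where c = "coef fs", OF C x])
      have "(\<Sum>n. coef fs n * (x\<^sup>2) ^ n) = (\<Sum>n. x\<^sup>2 * (coef fs (Suc n) * (x\<^sup>2) ^ n))"
        using suminf_split_head[OF s] fs0 by (simp add: mult_ac)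
      also have "\<dots> = x\<^sup>2 * (\<Sum>n. coef fs (Suc n) * (x\<^sup>2) ^ n)"
        by (intro suminf_mult summable_bounded_powser[where c = "\<lambda>n. coef fs (Suc n)", OF C x])
      finally have "(\<Sum>n. coef fs n * (x\<^sup>2) ^ n) = x * odd_series fs x"
        by (simp add: odd_series_def power2_eq_square)
      then have "(\<Sum>n. coef fs n * (x\<^sup>2) ^ n) * (rat_sin_deriv u / (1 - x\<^sup>2))
          = (x * rat_sin_deriv u / (1 - x\<^sup>2)) * odd_series fs x"
        by simp
      also have "x * rat_sin_deriv u / (1 - x\<^sup>2) = 2 * u / (1 - u\<^sup>2) + - (- 2 * u / (1 + u\<^sup>2))"
        using rat_sin_times_deriv_div_one_minus_square[OF u] by (simp add: x_def)
      finally have "complex_of_real ((\<Sum>n. coef fs n * (x\<^sup>2) ^ n) * (rat_sin_deriv u / (1 - x\<^sup>2))) =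
          (of_real (2 * u / (1 - u\<^sup>2)) + - of_real (- 2 * u / (1 + u\<^sup>2))) * of_real (odd_series fs x)"
        by (simp only: of_real_mult of_real_add of_real_minus)
      also have "\<dots> = ((letter 1 u + letter (- 1) u) + of_rat (- 1) * (letter \<i> u + letter (- \<i>) u)) * H u"
        unfolding letter_real(2)[OF u] letter_imaginary x_def H(2)[OF u] of_rat_minus of_rat_1 mult_minus1 ..
      finally show "complex_of_real ((\<Sum>n. coef fs n * ((rat_sin u)\<^sup>2) ^ n) * (rat_sin_deriv u / (1 - (rat_sin u)\<^sup>2))) =
          ((letter 1 u + letter (- 1) u) + of_rat (- 1) * (letter \<i> u + letter (- \<i>) u)) * H u"
        unfolding x_def .
    qed
    then show ?case by (simp add: add.commute)
  next
    case (Suc m)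
    then show ?case
      using odd_series_comb_raise[where fs = fs, OF Suc.hyps decay, where w = "m + w" and adm = False] by simp
  qed
  then show ?case by (simp add: fs_def w_def add_ac)
qed

lemma odd_series_comb_admissible:
  assumes "k \<ge> 1" "\<And>m. m \<in> set (m0 # ms) \<Longrightarrow> m \<ge> 1" "m0 \<ge> 2"
  shows "polylog_comb 4 True (sum_list (m0 # ms) + k)
           (\<lambda>u. of_real (odd_series (map odd_wt (m0 # ms) @ [binom_wt k]) (rat_sin u)))"
proof -
  obtain m where m: "m0 = Suc m" "m \<ge> 1"
    using assms(3) by (cases m0) auto
  have decay: "\<And>f. f \<in> set (map odd_wt ms @ [binom_wt k]) \<Longrightarrow> harmonic_decay f"
    using harmonic_decay_binom_wt[OF assms(1)] harmonic_decay_odd_wt assms(2) by auto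
  have "polylog_comb 4 False (sum_list (m # ms) + k)
           (\<lambda>u. of_real (odd_series (map odd_wt (m # ms) @ [binom_wt k]) (rat_sin u)))"
    using assms(2) m by (intro odd_series_comb[OF assms(1)]) auto
  then show ?thesis
    using odd_series_comb_raise[where fs = "map odd_wt ms @ [binom_wt k]", OF m(2) decay, where w = "sum_list (m # ms) + k" and adm = True] m
    by simp
qed

lemma odd_series_tendsto:
  assumes "summable (coef fs)" "coef fs 0 = 0"
  shows "((\<lambda>u. odd_series fs (rat_sin u)) \<longlongrightarrow> suminf (coef fs)) (at_left 1)"
proof -
  have s: "summable (\<lambda>n. coef fs (Suc n))" "(\<Sum>n. coef fs (Suc n)) = suminf (coef fs)"
    using assms by (auto simp: summable_Suc_iff suminf_split_head)
  have "isCont rat_sin 1" by (rule DERIV_isCont[OF DERIV_rat_sin])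
  then have sub_lim: "(rat_sin \<longlongrightarrow> 1) (at_left 1)"
    by (auto simp: isCont_def rat_sin_def intro: tendsto_within_subset)
  have "filterlim (\<lambda>u. (rat_sin u)\<^sup>2) (at_left 1) (at_left 1)"
    unfolding filterlim_at
  proof
    show "((\<lambda>u. (rat_sin u)\<^sup>2) \<longlongrightarrow> 1) (at_left 1)"
      using tendsto_power[OF sub_lim, of 2] by simp
    have "eventually (\<lambda>u::real. u \<in> {0<..<1}) (at_left 1)"
      using eventually_at_left_real[of 0 1] by simp
    then show "eventually (\<lambda>u. (rat_sin u)\<^sup>2 \<in> {..<1} \<and> (rat_sin u)\<^sup>2 \<noteq> 1) (at_left 1)"
    proof eventually_elim
      case (elim u)
      then have "(rat_sin u)\<^sup>2 < 1" using rat_sin_in_unit[OF elim] by (intro square_less_1) auto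
      then show ?case by auto
    qed
  qed
  from filterlim_compose[OF Abel_limit[OF s(1)] this]
  have "((\<lambda>u. \<Sum>n. coef fs (Suc n) * ((rat_sin u)\<^sup>2) ^ n) \<longlongrightarrow> suminf (coef fs)) (at_left 1)"
    by (simp add: s(2))
  from tendsto_mult[OF sub_lim this] show ?thesis
    by (simp add: odd_series_def)
qed

section \<open>Evaluating the alternating sum\<close>

lemma t_term_eq: "t_term ks ns = (\<Prod>j<length (map odd_wt ks). (map odd_wt ks ! j) (ns ! j))"
  unfolding t_term_def length_map by (rule prod.cong[OF refl]) (simp add: odd_wt_def)

lemma t_term_nonneg:
  assumes "length ks = length ns" "set ns \<subseteq> {1..}"
  shows "t_term ks ns \<ge> 0"
  unfolding t_term_def
proof (rule prod_nonneg)
  fix j assume "j \<in> {..<length ks}"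
  then have "ns ! j \<ge> 1" using assms by (metis atLeast_iff lessThan_iff nth_mem subsetD)
  then show "0 \<le> 1 / (2 * real (ns ! j) - 1) ^ (ks ! j)" by simp
qed

lemma multiple_t_star_eq: "multiple_t_star n ks = nested_star (map odd_wt ks) n"
  unfolding multiple_t_star_def sum_weak_tuples[symmetric] t_term_eq length_map ..

text \<open>
  All terms are nonnegative, so boundedness along the exhausting truncations \<open>n\<^sub>1 \<le> M\<close> already gives
  unordered summability, and the unordered sum is the limit of the truncations.
\<close>
lemma multiple_t_tendsto:
  assumes lim: "(\<lambda>M. nested (map odd_wt ks) 0 (M + 1)) \<longlonglongrightarrow> L"
  shows "multiple_t ks = L"
proof -
  define S where "S = strict_tuples (length ks)"
  define A where "A = (\<lambda>M. {ns \<in> S. set ns \<subseteq> {1..M}})"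
  have fin: "finite (A M)" for M
    unfolding A_def S_def by (rule finite_tuples)
  have nonneg: "t_term ks ns \<ge> 0" if "ns \<in> S" for ns
    using that by (intro t_term_nonneg) (auto simp: S_def strict_tuples_def)
  have sum: "sum (t_term ks) (A M) = nested (map odd_wt ks) 0 (M + 1)" for M
    unfolding A_def S_def sum_strict_tuples[symmetric] t_term_eq length_map ..
  have exhaust: "\<exists>N. \<forall>M\<ge>N. F \<subseteq> A M" if F: "finite F" "F \<subseteq> S" for F
  proof (intro exI allI impI subsetI)
    fix M ns assume M: "M \<ge> Max (insert 0 (\<Union>(set ` F)))" and ns: "ns \<in> F"
    have "l \<le> M" if "l \<in> set ns" for l
      using that ns F(1) by (intro order_trans[OF Max_ge M]) auto
    moreover have "set ns \<subseteq> {1..}" "ns \<in> S"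
      using ns F(2) by (auto simp: S_def strict_tuples_def)
    ultimately show "ns \<in> A M" by (auto simp: A_def)
  qed
  have filt: "filterlim A (finite_subsets_at_top S) sequentially"
    unfolding filterlim_finite_subsets_at_top
  proof (intro allI impI)
    fix F assume "finite F \<and> F \<subseteq> S"
    then obtain N where "\<forall>M\<ge>N. F \<subseteq> A M" using exhaust by blast
    then show "eventually (\<lambda>M. finite (A M) \<and> F \<subseteq> A M \<and> A M \<subseteq> S) sequentially"
      using fin by (auto simp: eventually_sequentially A_def)
  qed
  have "Bseq (\<lambda>M. nested (map odd_wt ks) 0 (M + 1))"
    using lim by (intro convergent_imp_Bseq) (auto simp: convergent_def)
  then obtain B where B: "\<And>M. \<bar>nested (map odd_wt ks) 0 (M + 1)\<bar> \<le> B"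
    by (auto simp: Bseq_def)
  have "bdd_above (sum (t_term ks) ` {F. F \<subseteq> S \<and> finite F})"
  proof (rule bdd_aboveI2)
    fix F assume "F \<in> {F. F \<subseteq> S \<and> finite F}"
    then obtain M where "F \<subseteq> A M" using exhaust[of F] by auto
    then have "sum (t_term ks) F \<le> sum (t_term ks) (A M)"
      using nonneg by (intro sum_mono2 fin) (auto simp: A_def)
    then show "sum (t_term ks) F \<le> B"
      using B[of M] unfolding sum by linarith
  qed
  then have "t_term ks summable_on S"
    by (intro nonneg_bdd_above_summable_on nonneg)
  from filterlim_compose[OF infsum_tendsto[OF this] filt]
  have "(\<lambda>M. nested (map odd_wt ks) 0 (M + 1)) \<longlonglongrightarrow> infsum (t_term ks) S"
    unfolding sum .
  then show ?thesis
    using LIMSEQ_unique[OF lim] by (simp add: multiple_t_def S_def)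
qed

lemma summable_coef_odd_wt:
  assumes "m \<ge> 2" "\<And>f. f \<in> set fs \<Longrightarrow> harmonic_decay f"
  shows "summable (coef (odd_wt m # fs))"
proof -
  have "summable (\<lambda>n. norm (odd_wt m n * nested fs 0 n))"
    by (rule summable_coef_square_decay[OF odd_wt_bound[OF assms(1)] assms(2)])
  then have "summable (\<lambda>n. odd_wt m n * nested fs 0 n)"
    by (rule summable_norm_cancel)
  moreover have "coef (odd_wt m # fs) = (\<lambda>n. odd_wt m n * nested fs 0 n)"
    by (rule ext) simp
  ultimately show ?thesis by simp
qed

lemma nested_odd_wt_convergent:
  assumes "ks \<noteq> [] \<Longrightarrow> hd ks \<ge> 2" "\<And>m. m \<in> set ks \<Longrightarrow> m \<ge> 1"
  shows "convergent (\<lambda>M. nested (map odd_wt ks) a (M + 1))"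
proof (cases ks)
  case Nil
  then show ?thesis by (simp add: convergent_const)
next
  case (Cons k ks')
  have "summable (\<lambda>n. norm (odd_wt k n * nested (map odd_wt ks') a n))"
    using assms Cons harmonic_decay_odd_wt
    by (intro summable_coef_square_decay[OF odd_wt_bound[of 2 k]]) auto
  then have s: "summable (\<lambda>n. odd_wt k n * nested (map odd_wt ks') a n)"
    by (rule summable_norm_cancel)
  define q where "q = (\<lambda>l. if l \<le> a then 0 else odd_wt k l * nested (map odd_wt ks') a l)"
  have "summable q"
    by (rule summable_cong[THEN iffD1, OF _ s])
      (auto simp: q_def intro: eventually_mono[OF eventually_gt_at_top[of a]])
  then have "(\<lambda>M. \<Sum>l\<le>M. q l) \<longlonglongrightarrow> suminf q"
    by (rule summable_LIMSEQ')
  moreover have "(\<Sum>l\<le>M. q l) = nested (map odd_wt ks) a (M + 1)" for M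
    unfolding Cons list.map nested.simps
    by (rule sum.mono_neutral_cong_right) (auto simp: q_def)
  ultimately show ?thesis by (auto simp: convergent_def)
qed

lemma nested_nonneg:
  fixes fs :: "(nat \<Rightarrow> real) list"
  assumes "\<And>f l. f \<in> set fs \<Longrightarrow> l \<ge> 1 \<Longrightarrow> f l \<ge> 0"
  shows "nested fs a b \<ge> 0"
  using assms
  by (induction fs arbitrary: b) (auto intro!: sum_nonneg mult_nonneg_nonneg)

lemma nested_antimono:
  fixes fs :: "(nat \<Rightarrow> real) list"
  assumes "\<And>f l. f \<in> set fs \<Longrightarrow> l \<ge> 1 \<Longrightarrow> f l \<ge> 0"
  shows "nested fs a b \<le> nested fs 0 b"
  using assms
proof (induction fs arbitrary: b)
  case (Cons f fs)
  have "nested (f # fs) a b \<le> (\<Sum>l\<in>{a<..<b}. f l * nested fs 0 l)"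
    unfolding nested.simps using Cons by (intro sum_mono mult_left_mono) auto
  also have "\<dots> \<le> (\<Sum>l\<in>{0<..<b}. f l * nested fs 0 l)"
    using Cons.prems by (intro sum_mono2 mult_nonneg_nonneg nested_nonneg) auto
  finally show ?case by simp
qed simp

lemma odd_wt_nonneg: "l \<ge> 1 \<Longrightarrow> odd_wt m l \<ge> 0"
  by (simp add: odd_wt_def)

lemma binom_wt_nonneg: "binom_wt k n \<ge> 0"
  using cbin_nonneg by (simp add: binom_wt_def)

lemma binom_wt_decay: "k \<ge> 1 \<Longrightarrow> n \<ge> 1 \<Longrightarrow> norm (binom_wt k n) \<le> real n powr (-3/2)"
proof -
  assume kn: "k \<ge> 1" "n \<ge> 1"
  have "norm (binom_wt k n) \<le> cbin n / real n"
    using binom_wt_bound[OF kn] by simp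
  also have "\<dots> \<le> real n powr (-1/2) / real n"
    by (intro divide_right_mono cbin_le_powr kn) auto
  also have "\<dots> = real n powr (-1/2 - 1)"
    using kn by (subst powr_diff) simp
  finally show ?thesis by simp
qed

lemma infsum_binomial_star:
  assumes k: "k \<ge> 1" and ks: "\<And>m. m \<in> set ks \<Longrightarrow> m \<ge> 1"
  shows "summable (\<lambda>n. binom_wt k n * nested_star (map odd_wt ks) n)"
    and "(\<Sum>\<^sub>\<infinity>n\<in>{1..}. multiple_t_star n ks / (real n ^ k * 4 ^ n) * real ((2 * n) choose n))
           = (\<Sum>n. binom_wt k n * nested_star (map odd_wt ks) n)"
proof -
  have decay: "\<And>f. f \<in> set (map odd_wt ks) \<Longrightarrow> harmonic_decay f"
    using harmonic_decay_odd_wt ks by auto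
  obtain D where D: "\<And>n. n \<ge> 1 \<Longrightarrow> norm (nested_star (map odd_wt ks) n) \<le> D * real n powr (1/4)"
    using nested_star_bound[OF decay] by blast
  have s: "summable (\<lambda>n. norm (binom_wt k n * nested_star (map odd_wt ks) n))"
    by (rule summable_times_quarter_growth[where C = 1, OF _ D])
      (use binom_wt_decay[OF k] in simp)
  then show s': "summable (\<lambda>n. binom_wt k n * nested_star (map odd_wt ks) n)"
    by (rule summable_norm_cancel)
  have "((\<lambda>n. binom_wt k n * nested_star (map odd_wt ks) n) has_sum (\<Sum>n. binom_wt k n * nested_star (map odd_wt ks) n)) UNIV"
    by (rule norm_summable_imp_has_sum[OF s summable_sums[OF s']])
  then have "infsum (\<lambda>n. binom_wt k n * nested_star (map odd_wt ks) n) UNIV = (\<Sum>n. binom_wt k n * nested_star (map odd_wt ks) n)"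
    by (rule infsumI)
  moreover have "(\<Sum>\<^sub>\<infinity>n\<in>{1..}. multiple_t_star n ks / (real n ^ k * 4 ^ n) * real ((2 * n) choose n))
      = infsum (\<lambda>n. binom_wt k n * nested_star (map odd_wt ks) n) UNIV"
    using k by (intro infsum_cong_neutral)
      (auto simp: multiple_t_star_eq binom_wt_def cbin_def not_le less_Suc_eq power_0_left mult_ac)
  ultimately show "(\<Sum>\<^sub>\<infinity>n\<in>{1..}. multiple_t_star n ks / (real n ^ k * 4 ^ n) * real ((2 * n) choose n))
      = (\<Sum>n. binom_wt k n * nested_star (map odd_wt ks) n)" by simp
qed

text \<open>
  The finite antipode relation passes to the limit twice: first the upper bound of the strict sums
  tends to infinity for each fixed \<open>n\<close>, then the sum over \<open>n\<close> is exchanged with this limit by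
  Tannery's theorem. The terms of the dominating series are the binomial weights, at most of order \<open>n\<^sup>-\<^sup>3\<^sup>/\<^sup>2\<close>,
  times a bound for the full nested sum.
\<close>
lemma alternating_sum_eq_suminf:
  assumes k: "k \<ge> 1" and ms: "ms \<noteq> []" "\<And>m. m \<in> set ms \<Longrightarrow> m \<ge> 1" "last ms \<ge> 2"
  shows "(\<Sum>j\<le>length ms. (-1) ^ j * multiple_t (rev (drop j ms)) *
            (\<Sum>n. binom_wt k n * nested_star (map odd_wt (take j ms)) n))
         = suminf (coef (map odd_wt (rev ms) @ [binom_wt k]))"
proof -
  define fs where "fs = map odd_wt ms"
  define T where "T = (\<lambda>j. multiple_t (rev (drop j ms)))"
  define Q where "Q = (\<lambda>n. \<Sum>j\<le>length ms. (-1) ^ j * T j * nested_star (take j fs) n)"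
  have fs_nonneg: "\<forall>f\<in>set (rev fs). \<forall>l\<ge>1. f l \<ge> 0"
    by (auto simp: fs_def intro: odd_wt_nonneg)
  have hd_ge_2: "hd (rev (drop j ms)) \<ge> 2" if "rev (drop j ms) \<noteq> []" for j
    using that ms(3) by (simp add: hd_rev last_drop)
  have T: "(\<lambda>M. nested (rev (drop j fs)) 0 (M + 1)) \<longlonglongrightarrow> T j" for j
  proof -
    have "convergent (\<lambda>M. nested (map odd_wt (rev (drop j ms))) 0 (M + 1))"
      using ms(2) by (intro nested_odd_wt_convergent hd_ge_2) (auto dest: in_set_dropD)
    then obtain L where L: "(\<lambda>M. nested (map odd_wt (rev (drop j ms))) 0 (M + 1)) \<longlonglongrightarrow> L"
      by (auto simp: convergent_def)
    with multiple_t_tendsto[OF L] show ?thesis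
      by (simp add: T_def fs_def rev_map drop_map)
  qed
  have Q: "(\<lambda>M. nested (rev fs) n (M + 1)) \<longlonglongrightarrow> Q n" for n
  proof (rule Lim_transform_eventually)
    show "(\<lambda>M. \<Sum>j\<le>length fs. (-1) ^ j * nested (rev (drop j fs)) 0 (M + 1) * nested_star (take j fs) n)
        \<longlonglongrightarrow> Q n"
      unfolding Q_def using T by (auto simp: fs_def intro!: tendsto_intros)
    show "eventually (\<lambda>M. (\<Sum>j\<le>length fs. (-1) ^ j * nested (rev (drop j fs)) 0 (M + 1) *
        nested_star (take j fs) n) = nested (rev fs) n (M + 1)) sequentially"
      using eventually_ge_at_top[of n] by eventually_elim (intro antipode_tail, simp)
  qed
  have "Bseq (\<lambda>M. nested (rev fs) 0 (M + 1))"
    using Q[of 0] by (intro convergent_imp_Bseq) (auto simp: convergent_def)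
  then obtain B where B: "\<And>M. \<bar>nested (rev fs) 0 (M + 1)\<bar> \<le> B"
    by (auto simp: Bseq_def)
  \<comment> \<open>the sum of \<open>a n M\<close> over \<open>n\<close> is the nested sum truncated at \<open>M\<close>, with \<open>n\<close> the innermost variable\<close>
  define a where "a = (\<lambda>n M. if n \<in> {0<..<M + 1} then binom_wt k n * nested (rev fs) n (M + 1) else 0)"
  have "(\<lambda>M. \<Sum>n. a n M) \<longlonglongrightarrow> (\<Sum>n. binom_wt k n * Q n)"
  proof (rule tannerys_theorem[THEN conjunct2, THEN conjunct2])
    show "(\<lambda>M. a n M) \<longlonglongrightarrow> binom_wt k n * Q n" for n
    proof (cases "n = 0")
      case True
      then show ?thesis using k by (simp add: a_def binom_wt_def power_0_left)
    next
      case False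
      have "(\<lambda>M. binom_wt k n * nested (rev fs) n (M + 1)) \<longlonglongrightarrow> binom_wt k n * Q n"
        by (intro tendsto_intros Q)
      moreover have "eventually (\<lambda>M. binom_wt k n * nested (rev fs) n (M + 1) = a n M) sequentially"
        using eventually_ge_at_top[of n] by eventually_elim (use False in \<open>auto simp: a_def\<close>)
      ultimately show ?thesis by (rule Lim_transform_eventually)
    qed
    have "norm (a n M) \<le> B * binom_wt k n" for n M
    proof -
      have "0 \<le> nested (rev fs) n (M + 1)"
        by (rule nested_nonneg) (use fs_nonneg in auto)
      moreover have "nested (rev fs) n (M + 1) \<le> nested (rev fs) 0 (M + 1)"
        by (rule nested_antimono) (use fs_nonneg in auto)
      then have "nested (rev fs) n (M + 1) \<le> B"
        using B[of M] by linarith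
      ultimately have "binom_wt k n * nested (rev fs) n (M + 1) \<le> binom_wt k n * B"
          "0 \<le> binom_wt k n * nested (rev fs) n (M + 1)" "0 \<le> binom_wt k n * B"
        using binom_wt_nonneg[of k n] by (auto intro: mult_left_mono)
      then show ?thesis by (simp add: a_def mult.commute)
    qed
    then show "eventually (\<lambda>(n, M). norm (a n M) \<le> B * binom_wt k n) (at_top \<times>\<^sub>F sequentially)"
      by (intro always_eventually) auto
    show "summable (\<lambda>n. B * binom_wt k n)"
      using infsum_binomial_star(1)[OF k, of "[]"] by (intro summable_mult) simp
  qed simp
  moreover have "(\<Sum>n. a n M) = (\<Sum>l\<le>M. coef (rev fs @ [binom_wt k]) l)" for M
  proof -
    have "(\<Sum>n. a n M) = (\<Sum>n\<in>{0<..<M + 1}. a n M)"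
      by (rule suminf_finite) (auto simp: a_def)
    also have "\<dots> = nested (rev fs @ [binom_wt k]) 0 (M + 1)"
      unfolding nested_snoc by (rule sum.cong) (auto simp: a_def)
    also have "\<dots> = (\<Sum>l\<le>M. coef (rev fs @ [binom_wt k]) l)"
    proof -
      obtain f fs' where "rev fs = f # fs'"
        using ms(1) by (cases "rev fs") (auto simp: fs_def)
      then have "coef (rev fs @ [binom_wt k]) 0 = 0"
        by (cases "fs' @ [binom_wt k]") auto
      then show ?thesis using sum_coef[of "rev fs @ [binom_wt k]" M] by simp
    qed
    finally show ?thesis .
  qed
  moreover have "summable (coef (rev fs @ [binom_wt k]))"
  proof -
    obtain m ms' where m: "rev ms = m # ms'"
      using ms(1) by (cases "rev ms") auto
    have "m \<ge> 2" using ms(3) hd_rev[of ms] m by simp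
    moreover have "set ms' \<subseteq> set ms" using m by (metis set_rev set_subset_Cons)
    then have "harmonic_decay f" if "f \<in> set (map odd_wt ms' @ [binom_wt k])" for f
      using that ms(2) harmonic_decay_binom_wt[OF k] harmonic_decay_odd_wt by auto
    ultimately have "summable (coef (odd_wt m # (map odd_wt ms' @ [binom_wt k])))"
      by (rule summable_coef_odd_wt)
    then show ?thesis unfolding fs_def rev_map m by simp
  qed
  ultimately have "suminf (coef (rev fs @ [binom_wt k])) = (\<Sum>n. binom_wt k n * Q n)"
    using LIMSEQ_unique summable_LIMSEQ' by (metis (no_types, lifting) ext)
  also have "\<dots> = (\<Sum>n. \<Sum>j\<le>length ms. (-1) ^ j * T j * (binom_wt k n * nested_star (take j fs) n))"
    unfolding Q_def sum_distrib_left by (simp add: mult_ac)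
  also have "\<dots> = (\<Sum>j\<le>length ms. \<Sum>n. (-1) ^ j * T j * (binom_wt k n * nested_star (take j fs) n))"
    using infsum_binomial_star(1)[OF k] ms(2)
    by (intro suminf_sum summable_mult) (auto simp: fs_def take_map dest: in_set_takeD)
  also have "\<dots> = (\<Sum>j\<le>length ms. (-1) ^ j * T j * (\<Sum>n. binom_wt k n * nested_star (take j fs) n))"
    using infsum_binomial_star(1)[OF k] ms(2)
    by (intro sum.cong refl suminf_mult) (auto simp: fs_def take_map dest: in_set_takeD)
  finally show ?thesis
    by (simp add: T_def fs_def take_map rev_map)
qed

theorem theorem2p4:
  fixes k p :: nat and m :: "nat \<Rightarrow> nat"
  assumes "k \<ge> 1" and "p \<ge> 1"
    and "\<And>i. i \<in> {1..p} \<Longrightarrow> m i \<ge> 1"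
    and "m p \<ge> 2"
  shows "complex_of_real
           (\<Sum>j=1..p+1. (-1) ^ (j - 1) * multiple_t (rev (map m [j..<p+1])) *
              (\<Sum>\<^sub>\<infinity>n\<in>{1..}. multiple_t_star n (map m [1..<j]) / (real n ^ k * 4 ^ n) *
                 real ((2 * n) choose n)))
         \<in> CMZV 4 ((\<Sum>i=1..p. m i) + k)"
proof -
  define ms where "ms = map m [1..<p + 1]"
  have len: "length ms = p" by (simp add: ms_def)
  have pos: "\<And>l. l \<in> set ms \<Longrightarrow> l \<ge> 1"
    using assms(3) by (auto simp: ms_def)
  have ms_split: "ms = map m [1..<p] @ [m p]"
    using assms(2) by (simp add: ms_def)
  then have rev_ms: "rev ms = m p # rev (map m [1..<p])" and ne: "ms \<noteq> []" and last: "last ms \<ge> 2"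
    using assms(4) by auto
  have drop: "map m [j + 1..<p + 1] = drop j ms" and take: "map m [1..<j + 1] = take j ms" if "j \<le> p" for j
    using that by (simp_all add: ms_def drop_map take_map take_upt del: upt_Suc)
  have "(\<Sum>j=1..p+1. (-1) ^ (j - 1) * multiple_t (rev (map m [j..<p+1])) *
              (\<Sum>\<^sub>\<infinity>n\<in>{1..}. multiple_t_star n (map m [1..<j]) / (real n ^ k * 4 ^ n) *
                 real ((2 * n) choose n)))
      = (\<Sum>j\<le>p. (-1) ^ j * multiple_t (rev (drop j ms)) *
          (\<Sum>n. binom_wt k n * nested_star (map odd_wt (take j ms)) n))"
  proof (rule sum.reindex_bij_witness[of _ "\<lambda>j. j + 1" "\<lambda>j. j - 1"])
    fix j assume j: "j \<in> {1..p + 1}"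
    then have "j - 1 \<le> p" "j - 1 + 1 = j" by auto
    with drop[of "j - 1"] take[of "j - 1"]
    have "map m [j..<p + 1] = drop (j - 1) ms" "map m [1..<j] = take (j - 1) ms" by auto
    moreover have "\<And>l. l \<in> set (take (j - 1) ms) \<Longrightarrow> l \<ge> 1"
      using pos by (auto dest: in_set_takeD)
    ultimately show "(-1) ^ (j - 1) * multiple_t (rev (drop (j - 1) ms)) *
          (\<Sum>n. binom_wt k n * nested_star (map odd_wt (take (j - 1) ms)) n) =
        (-1) ^ (j - 1) * multiple_t (rev (map m [j..<p+1])) *
          (\<Sum>\<^sub>\<infinity>n\<in>{1..}. multiple_t_star n (map m [1..<j]) / (real n ^ k * 4 ^ n) *
                 real ((2 * n) choose n))"
      using infsum_binomial_star(2)[OF assms(1), of "take (j - 1) ms"] by simp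
  qed auto
  also have "\<dots> = suminf (coef (map odd_wt (rev ms) @ [binom_wt k]))"
    using alternating_sum_eq_suminf[OF assms(1) ne pos last] by (simp add: len)
  finally have sum_eq: "(\<Sum>j=1..p+1. (-1) ^ (j - 1) * multiple_t (rev (map m [j..<p+1])) *
              (\<Sum>\<^sub>\<infinity>n\<in>{1..}. multiple_t_star n (map m [1..<j]) / (real n ^ k * 4 ^ n) *
                 real ((2 * n) choose n)))
      = suminf (coef (map odd_wt (rev ms) @ [binom_wt k]))" .
  define fs where "fs = map odd_wt (rev (map m [1..<p])) @ [binom_wt k]"
  have fs: "map odd_wt (rev ms) @ [binom_wt k] = odd_wt (m p) # fs"
    by (simp add: rev_ms fs_def)
  have decay: "\<And>f. f \<in> set fs \<Longrightarrow> harmonic_decay f"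
    using assms(1,3) harmonic_decay_binom_wt harmonic_decay_odd_wt by (auto simp: fs_def)
  have lim: "((\<lambda>u. odd_series (odd_wt (m p) # fs) (rat_sin u)) \<longlongrightarrow> suminf (coef (odd_wt (m p) # fs))) (at_left 1)"
  proof (rule odd_series_tendsto)
    show "summable (coef (odd_wt (m p) # fs))"
      using decay by (rule summable_coef_odd_wt[OF assms(4)])
    show "coef (odd_wt (m p) # fs) 0 = 0"
      by (cases fs) (auto simp: fs_def)
  qed
  have weight: "sum_list (rev ms) = (\<Sum>i=1..p. m i)"
    by (simp add: ms_def sum_list_rev interv_sum_list_conv_sum_set_nat atLeastLessThanSuc_atLeastAtMost del: upt_Suc)
  have "polylog_comb 4 True ((\<Sum>i=1..p. m i) + k) (\<lambda>u. of_real (odd_series (odd_wt (m p) # fs) (rat_sin u)))"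
  proof -
    have "\<And>l. l \<in> set (m p # rev (map m [1..<p])) \<Longrightarrow> l \<ge> 1"
      using pos unfolding rev_ms[symmetric] set_rev .
    from odd_series_comb_admissible[where ms = "rev (map m [1..<p])", OF assms(1) this assms(4)] show ?thesis
      using weight unfolding rev_ms fs_def by simp
  qed
  from polylog_comb_tendsto[OF this] obtain c where c: "c \<in> CMZV 4 ((\<Sum>i=1..p. m i) + k)"
      "((\<lambda>u. complex_of_real (odd_series (odd_wt (m p) # fs) (rat_sin u))) \<longlongrightarrow> c) (at_left 1)"
    by auto
  have "c = of_real (suminf (coef (odd_wt (m p) # fs)))"
    by (rule tendsto_unique[OF _ c(2) tendsto_of_real[OF lim]]) simp
  then show ?thesis
    using c(1) unfolding sum_eq fs by simp
qed

end
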